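(* Let $\theta$ be one of the $2\times 2$ real matrices in the list given in the context, and let $\Sigma_{G(\theta)}$ be a one-input linear control system on $G(\theta)$ with linear vector field $\mathcal{X}=(A,\xi)$, of nilrank one (i.e. $\mathrm{rank}\,A=1$) and satisfying the LARC. Let $H=\{0\}\times\ker A$ and let $\pi:G(\theta)\to H\setminus G(\theta)$ be the canonical projection. Then $\Sigma_{G(\theta)}$ admits a unique control set with nonempty interior $\mathcal{C}_{G(\theta)}$, and it satisfies $$\mathcal{C}_{G(\theta)}=\pi^{-1}(\mathcal{C}_{H\setminus G(\theta)})=\mathcal{C}_{H\setminus G(\theta)}\times\ker A,$$ where $\mathcal{C}_{H\setminus G(\theta)}$ is the unique control set with nonempty interior of the induced linear control system on $H\setminus G(\theta)$. Moreover, $\mathcal{C}_{G(\theta)}$ is open if $\mathrm{tr}\,A>0$, it is closed if $\mathrm{tr}\,A<0$, and $\mathcal{C}_{G(\theta)}=G(\theta)$ if $\mathrm{tr}\,A=0$.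
   Context: **Groups.** $\theta$ is one of $\begin{pmatrix}1&1\\0&1\end{pmatrix}$; $\begin{pmatrix}1&0\\0&\gamma\end{pmatrix}$ with $|\gamma|\le 1$; $\begin{pmatrix}\gamma&-1\\1&\gamma\end{pmatrix}$ with $\gamma\in\mathbb{R}$. Put $\rho_t=e^{t\theta}$. $G(\theta)=\mathbb{R}\times_\rho\mathbb{R}^2$ is $\mathbb{R}\times\mathbb{R}^2$ with product $(t_1,v_1)(t_2,v_2)=(t_1+t_2,v_1+\rho_{t_1}v_2)$. Put $\Lambda_t^\theta w=\int_0^t e^{s\theta}w\,ds$. **Linear control systems on $G(\theta)$.** A linear vector field $\mathcal{X}=(A,\xi)$, with $\xi\in\mathbb{R}^2$ and $A\in\mathfrak{gl}(2,\mathbb{R})$, $A\theta=\theta A$, is $\mathcal{X}(t,v)=(0,Av+\Lambda_t^\theta\xi)$; a left-invariant vector field $Y=(\alpha,\eta)\in\mathbb{R}\times\mathbb{R}^2$ is $Y(t,v)=(\alpha,\rho_t\eta)$. A one-input linear control system (LCS) $\Sigma_{G(\theta)}$ is $\dot g=\mathcal{X}(g)+uY(g)$, i.e. $\dot t=u\alpha$, $\dot v=Av+\Lambda_t^\theta\xi+u\rho_t\eta$, with $u\in\Omega=[u^-,u^+]$, $u^-<0<u^+$. The nilrank of $\Sigma_{G(\theta)}$ is the rank of $A$. **Control systems.** For a system $\dot x=f_0(x)+u f_1(x)$ on a manifold $M$, $\mathcal{U}$ is the set of piecewise constant functions $\mathbf{u}$ with values in $\Omega$, and $\phi(s,x,\mathbf{u})$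 is the solution with $\phi(0,x,\mathbf{u})=x$ (defined for all $s\in\mathbb{R}$). $\mathcal{O}^+(x)=\{\phi(S,x,\mathbf{u}):S>0,\mathbf{u}\in\mathcal{U}\}$. The system satisfies the Lie algebra rank condition (LARC) if the smallest Lie algebra of vector fields containing $f_0,f_1$ spans $T_xM$ at every $x\in M$. (For $\Sigma_{G(\theta)}$: equivalently, $\alpha\ne0$ and $w=\alpha\xi+A\eta$ is nonzero and not a common eigenvector of $A$ and $\theta$.) A subset $D\subset M$ is a control set if (i) for every $x\in D$ there is $\mathbf{u}\in\mathcal{U}$ with $\phi(\mathbb{R}^+,x,\mathbf{u})\subset D$; (ii) $D\subset\overline{\mathcal{O}^+(x)}$ for every $x\in D$; (iii) $D$ is maximal with respect to (i) and (ii). **Quotient and identification.** When $\mathrm{rank}\,A=1$, $H=\{0\}\times\ker A$ is a closed normal one-dimensional subgroup of $G(\theta)$, invariant under the flow of $\mathcal{X}$; the induced system on the two-dimensional Lie group $H\setminus G(\theta)$ (cosets $Hg$, $\pi(g)=Hg$) is the one whose vector fields are the $\pi$-projections of $\mathcal{X}$ and $Y$. Let $R$ be the counterclockwise rotation by $\pi/2$ and $w\in\ker A$ a unit vector. Then $H\setminus G(\theta)$ is identified with $\mathbb{R}^2$ via $\pi(t,v)=(t,\langle v,Rw\rangle)$, and, seeing $G(\theta)$ as the vector space $\mathbb{R}^3$ with basis $\{(1,0),(0,Rw),(0,w)\}$, the product $\mathcal{C}_{H\setminus G(\theta)}\times\ker A$ is the set of points $t(1,0)+s_1(0,Rw)+s_2(0,w)$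 with $(t,s_1)\in\mathcal{C}_{H\setminus G(\theta)}$ and $s_2\in\mathbb{R}$. *)

theory Defs
  imports "HOL-Analysis.Analysis"
begin

section \<open>Control-affine systems with one input on a Euclidean space\<close>

text \<open>Vector fields on the manifold \<open>'a\<close> are maps \<open>'a \<Rightarrow> 'a\<close>. Controls are defined on all of
  \<open>\<real>\<close>, and ``piecewise constant'' means finitely many switches in every bounded interval.
  The value of a control at a switching time is arbitrary; it does not affect the solutions.\<close>

definition locally_finite_times :: "real set \<Rightarrow> bool" where
  "locally_finite_times P \<longleftrightarrow> (\<forall>a b. finite (P \<inter> {a..b}))"

definition piecewise_constant :: "(real \<Rightarrow> real) \<Rightarrow> bool" where
  "piecewise_constant u \<longleftrightarrow>
     (\<exists>P. locally_finite_times P \<and> (\<forall>s t. s \<le> t \<longrightarrow> {s..t} \<inter> P = {} \<longrightarrow> u s = u t))"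

definition controls :: "real set \<Rightarrow> (real \<Rightarrow> real) set" where
  "controls \<Omega> = {u. piecewise_constant u \<and> range u \<subseteq> \<Omega>}"

text \<open>\<open>solution f0 f1 u x \<phi>\<close> says that \<open>\<phi>\<close> is the map \<open>s \<mapsto> \<phi>(s, x, u)\<close>, defined for all real \<open>s\<close>:
  it is continuous and satisfies the differential equation away from the switching times.\<close>

definition solution ::
  "('a::euclidean_space \<Rightarrow> 'a) \<Rightarrow> ('a \<Rightarrow> 'a) \<Rightarrow> (real \<Rightarrow> real) \<Rightarrow> 'a \<Rightarrow> (real \<Rightarrow> 'a) \<Rightarrow> bool" where
  "solution f0 f1 u x \<phi> \<longleftrightarrow>
     \<phi> 0 = x \<and> continuous_on UNIV \<phi> \<and>
     (\<exists>P. locally_finite_times P \<and>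
        (\<forall>s. s \<notin> P \<longrightarrow> (\<phi> has_vector_derivative (f0 (\<phi> s) + u s *\<^sub>R f1 (\<phi> s))) (at s)))"

definition positive_orbit ::
  "('a::euclidean_space \<Rightarrow> 'a) \<Rightarrow> ('a \<Rightarrow> 'a) \<Rightarrow> real set \<Rightarrow> 'a \<Rightarrow> 'a set" where
  "positive_orbit f0 f1 \<Omega> x =
     {\<phi> S | \<phi> S u. S > 0 \<and> u \<in> controls \<Omega> \<and> solution f0 f1 u x \<phi>}"

definition weakly_invariant ::
  "('a::euclidean_space \<Rightarrow> 'a) \<Rightarrow> ('a \<Rightarrow> 'a) \<Rightarrow> real set \<Rightarrow> 'a set \<Rightarrow> bool" where
  "weakly_invariant f0 f1 \<Omega> D \<longleftrightarrow>
     (\<forall>x\<in>D. \<exists>u\<in>controls \<Omega>. \<exists>\<phi>. solution f0 f1 u x \<phi> \<and> \<phi> ` {0..} \<subseteq> D)"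

definition approx_transitive ::
  "('a::euclidean_space \<Rightarrow> 'a) \<Rightarrow> ('a \<Rightarrow> 'a) \<Rightarrow> real set \<Rightarrow> 'a set \<Rightarrow> bool" where
  "approx_transitive f0 f1 \<Omega> D \<longleftrightarrow> (\<forall>x\<in>D. D \<subseteq> closure (positive_orbit f0 f1 \<Omega> x))"

definition control_set ::
  "('a::euclidean_space \<Rightarrow> 'a) \<Rightarrow> ('a \<Rightarrow> 'a) \<Rightarrow> real set \<Rightarrow> 'a set \<Rightarrow> bool" where
  "control_set f0 f1 \<Omega> D \<longleftrightarrow>
     weakly_invariant f0 f1 \<Omega> D \<and> approx_transitive f0 f1 \<Omega> D \<and>
     (\<forall>D'. D \<subseteq> D' \<and> weakly_invariant f0 f1 \<Omega> D' \<and> approx_transitive f0 f1 \<Omega> D' \<longrightarrow> D' = D)"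

definition unique_control_set_with_interior ::
  "('a::euclidean_space \<Rightarrow> 'a) \<Rightarrow> ('a \<Rightarrow> 'a) \<Rightarrow> real set \<Rightarrow> 'a set \<Rightarrow> bool" where
  "unique_control_set_with_interior f0 f1 \<Omega> C \<longleftrightarrow>
     control_set f0 f1 \<Omega> C \<and> interior C \<noteq> {} \<and>
     (\<forall>D. control_set f0 f1 \<Omega> D \<and> interior D \<noteq> {} \<longrightarrow> D = C)"

text \<open>\<open>frechet_derivative\<close> is meaningful only for differentiable maps; every member of
  \<open>generated_lie_algebra S\<close> is smooth when the members of \<open>S\<close> are.\<close>

definition lie_bracket ::
  "('a::euclidean_space \<Rightarrow> 'a) \<Rightarrow> ('a \<Rightarrow> 'a) \<Rightarrow> 'a \<Rightarrow> 'a" where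
  "lie_bracket X Y =
     (\<lambda>x. frechet_derivative Y (at x) (X x) - frechet_derivative X (at x) (Y x))"

inductive_set generated_lie_algebra ::
  "('a::euclidean_space \<Rightarrow> 'a) set \<Rightarrow> ('a \<Rightarrow> 'a) set" for S where
  base: "X \<in> S \<Longrightarrow> X \<in> generated_lie_algebra S"
| zero: "(\<lambda>x. 0) \<in> generated_lie_algebra S"
| add: "X \<in> generated_lie_algebra S \<Longrightarrow> Y \<in> generated_lie_algebra S \<Longrightarrow>
    (\<lambda>x. X x + Y x) \<in> generated_lie_algebra S"
| scale: "X \<in> generated_lie_algebra S \<Longrightarrow> (\<lambda>x. c *\<^sub>R X x) \<in> generated_lie_algebra S"
| bracket: "X \<in> generated_lie_algebra S \<Longrightarrow> Y \<in> generated_lie_algebra S \<Longrightarrow>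
    lie_bracket X Y \<in> generated_lie_algebra S"

definition LARC :: "('a::euclidean_space \<Rightarrow> 'a) \<Rightarrow> ('a \<Rightarrow> 'a) \<Rightarrow> bool" where
  "LARC f0 f1 \<longleftrightarrow> (\<forall>x. span ((\<lambda>Z. Z x) ` generated_lie_algebra {f0, f1}) = UNIV)"


section \<open>The groups \<open>G(\<theta>)\<close> and their linear control systems\<close>

definition mat_exp :: "real^'n^'n \<Rightarrow> real^'n^'n" where
  "mat_exp M = (\<Sum>n. (1 / fact n) *\<^sub>R ((**) M ^^ n) (mat 1))"

definition admissible :: "real^2^2 \<Rightarrow> bool" where
  "admissible \<theta> \<longleftrightarrow>
     \<theta> = vector [vector [1, 1], vector [0, 1]] \<or>
     (\<exists>\<gamma>. \<bar>\<gamma>\<bar> \<le> 1 \<and> \<theta> = vector [vector [1, 0], vector [0, \<gamma>]]) \<or>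
     (\<exists>\<gamma>. \<theta> = vector [vector [\<gamma>, -1], vector [1, \<gamma>]])"

definition rho :: "real^2^2 \<Rightarrow> real \<Rightarrow> real^2^2" where
  "rho \<theta> t = mat_exp (t *\<^sub>R \<theta>)"

fun group_mult :: "real^2^2 \<Rightarrow> real \<times> (real^2) \<Rightarrow> real \<times> (real^2) \<Rightarrow> real \<times> (real^2)" where
  "group_mult \<theta> (t1, v1) (t2, v2) = (t1 + t2, v1 + rho \<theta> t1 *v v2)"

text \<open>The interval integral is oriented, so this is also correct for negative \<open>t\<close>.\<close>

definition Lambda :: "real^2^2 \<Rightarrow> real \<Rightarrow> real^2 \<Rightarrow> real^2" where
  "Lambda \<theta> t w = (LBINT s=ereal 0..ereal t. rho \<theta> s *v w)"

fun linear_field ::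
  "real^2^2 \<Rightarrow> real^2^2 \<Rightarrow> real^2 \<Rightarrow> real \<times> (real^2) \<Rightarrow> real \<times> (real^2)" where
  "linear_field \<theta> A \<xi> (t, v) = (0, A *v v + Lambda \<theta> t \<xi>)"

fun left_invariant_field ::
  "real^2^2 \<Rightarrow> real \<Rightarrow> real^2 \<Rightarrow> real \<times> (real^2) \<Rightarrow> real \<times> (real^2)" where
  "left_invariant_field \<theta> \<alpha> \<eta> (t, v) = (\<alpha>, rho \<theta> t *v \<eta>)"


section \<open>The quotient by \<open>H = {0} \<times> ker A\<close>\<close>

definition kernel_subgroup :: "real^2^2 \<Rightarrow> (real \<times> (real^2)) set" where
  "kernel_subgroup A = {0} \<times> {v. A *v v = 0}"

definition coset :: "real^2^2 \<Rightarrow> real^2^2 \<Rightarrow> real \<times> (real^2) \<Rightarrow> (real \<times> (real^2)) set" where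
  "coset \<theta> A g = (\<lambda>h. group_mult \<theta> h g) ` kernel_subgroup A"

definition rot90 :: "real^2 \<Rightarrow> real^2" where
  "rot90 v = vector [- (v $ 2), v $ 1]"

text \<open>The canonical projection \<open>g \<mapsto> Hg\<close>, with \<open>H\G(\<theta>)\<close> identified with \<open>\<real>\<^sup>2\<close> by means of a unit
  vector \<open>w\<close> of \<open>ker A\<close>. Lemmas \<open>quot_proj_eq_iff\<close> and \<open>surj_quot_proj\<close> below say that this is
  indeed a bijective labelling of the cosets \<open>Hg\<close>.\<close>

fun quot_proj :: "real^2 \<Rightarrow> real \<times> (real^2) \<Rightarrow> real \<times> real" where
  "quot_proj w (t, v) = (t, v \<bullet> rot90 w)"

text \<open>The projection of the vector field \<open>X\<close> along \<open>p\<close> is the unique \<open>p\<close>-related field; for the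
  fields of a linear control system it exists by the two lemmas that end this theory.\<close>

definition related_field ::
  "('a::euclidean_space \<Rightarrow> 'b::euclidean_space) \<Rightarrow> ('a \<Rightarrow> 'a) \<Rightarrow> ('b \<Rightarrow> 'b) \<Rightarrow> bool" where
  "related_field p X F \<longleftrightarrow> (\<forall>g. F (p g) = frechet_derivative p (at g) (X g))"

definition proj_field ::
  "('a::euclidean_space \<Rightarrow> 'b::euclidean_space) \<Rightarrow> ('a \<Rightarrow> 'a) \<Rightarrow> 'b \<Rightarrow> 'b" where
  "proj_field p X = (THE F. related_field p X F)"

text \<open>The product \<open>C \<times> ker A\<close> in the basis \<open>(1, 0), (0, Rw), (0, w)\<close> of \<open>G(\<theta>) = \<real>\<^sup>3\<close>.\<close>

definition times_kernel :: "real^2 \<Rightarrow> (real \<times> real) set \<Rightarrow> (real \<times> (real^2)) set" where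
  "times_kernel w C =
     {t *\<^sub>R (1, 0) + s1 *\<^sub>R (0, rot90 w) + s2 *\<^sub>R (0, w) | t s1 s2. (t, s1) \<in> C}"

lemma rot90_decomp:
  assumes "norm w = 1"
  shows "v = (v \<bullet> rot90 w) *\<^sub>R rot90 w + (v \<bullet> w) *\<^sub>R w"
    and "rot90 w \<bullet> rot90 w = 1" and "w \<bullet> rot90 w = 0"
proof -
  have "w \<bullet> w = 1"
    using assms by (simp add: norm_eq_1)
  then have n: "w $ 1 * w $ 1 + w $ 2 * w $ 2 = 1"
    by (simp add: inner_vec_def sum_2)
  show "v = (v \<bullet> rot90 w) *\<^sub>R rot90 w + (v \<bullet> w) *\<^sub>R w"
    using n by (simp add: vec_eq_iff forall_2 inner_vec_def sum_2 rot90_def) algebra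
  show "rot90 w \<bullet> rot90 w = 1" "w \<bullet> rot90 w = 0"
    using n by (simp_all add: inner_vec_def sum_2 rot90_def)
qed

lemma rho_0: "rho \<theta> 0 = mat 1"
proof -
  have z: "((**) (0::real^2^2) ^^ n) (mat 1) = (if n = 0 then mat 1 else 0)" for n
    by (cases n) (simp_all add: matrix_matrix_mult_def vec_eq_iff)
  have "(\<Sum>n. (1 / fact n) *\<^sub>R ((**) (0::real^2^2) ^^ n) (mat 1))
      = (\<Sum>n\<in>{0}. (1 / fact n) *\<^sub>R ((**) (0::real^2^2) ^^ n) (mat 1))"
    by (rule suminf_finite) (auto simp: z)
  then show ?thesis
    by (simp add: rho_def mat_exp_def)
qed

lemma surj_quot_proj:
  assumes "norm w = 1"
  shows "surj (quot_proj w)"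
proof (rule surjI)
  fix y :: "real \<times> real"
  show "quot_proj w ((\<lambda>(t, s). (t, s *\<^sub>R rot90 w)) y) = y"
    by (cases y) (simp add: rot90_decomp(2)[OF assms])
qed

lemma quot_proj_eq_iff:
  assumes "A *v w = 0" and "norm w = 1" and "rank A = 1"
  shows "quot_proj w g = quot_proj w h \<longleftrightarrow> coset \<theta> A g = coset \<theta> A h"
proof -
  have "A \<noteq> 0"
    using assms(3) by auto
  have Av: "A *v v = (v \<bullet> rot90 w) *\<^sub>R (A *v rot90 w)" for v
    by (subst rot90_decomp(1)[OF assms(2), of v])
       (simp add: matrix_vector_right_distrib matrix_vector_mult_scaleR assms(1))
  have "A *v rot90 w \<noteq> 0"
  proof
    assume "A *v rot90 w = 0"
    then have "A *v v = 0" for v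
      by (subst Av) simp
    then have "A = 0"
      by (metis matrix_eq matrix_vector_mult_0)
    with \<open>A \<noteq> 0\<close> show False ..
  qed
  then have ker: "A *v v = 0 \<longleftrightarrow> v \<bullet> rot90 w = 0" for v
    by (subst Av) simp
  have cos: "coset \<theta> A g = {k. quot_proj w k = quot_proj w g}" for g
  proof -
    obtain t v where g: "g = (t, v)"
      by (cases g)
    have "k \<in> coset \<theta> A g \<longleftrightarrow> quot_proj w k = quot_proj w g" for k
    proof -
      obtain t' v' where k: "k = (t', v')"
        by (cases k)
      have "k \<in> coset \<theta> A g \<longleftrightarrow> t' = t \<and> A *v (v' - v) = 0"
        by (auto simp: g k coset_def kernel_subgroup_def rho_0 image_iff intro: bexI[of _ "(0, v' - v)"])
      then show ?thesis
        by (simp add: g k ker inner_diff_left)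
    qed
    then show ?thesis
      by blast
  qed
  show ?thesis
    unfolding cos set_eq_iff mem_Collect_eq by metis
qed

lemma proj_field_eqI:
  assumes "surj p" and "related_field p X F"
  shows "proj_field p X = F" and "\<exists>!F. related_field p X F"
proof -
  have "F' = F" if "related_field p X F'" for F'
    using that assms unfolding related_field_def by (metis surjD ext)
  with assms(2) show "proj_field p X = F" "\<exists>!F. related_field p X F"
    unfolding proj_field_def by blast+
qed

lemma frechet_derivative_quot_proj:
  "frechet_derivative (quot_proj w) (at g) = quot_proj w"
proof -
  have e: "quot_proj w = (\<lambda>g. (fst g, snd g \<bullet> rot90 w))"
    by (auto simp: fun_eq_iff)
  have "(quot_proj w has_derivative quot_proj w) (at g)"
    unfolding e by (auto intro!: derivative_eq_intros)
  then show ?thesis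
    by (simp add: frechet_derivative_at[symmetric])
qed

lemma ex1_related_linear_field:
  assumes "A *v w = 0" and "norm w = 1"
  shows "\<exists>!F. related_field (quot_proj w) (linear_field \<theta> A \<xi>) F"
proof (rule proj_field_eqI(2)[OF surj_quot_proj[OF assms(2)]])
  have Av: "A *v v = (v \<bullet> rot90 w) *\<^sub>R (A *v rot90 w)" for v
    by (subst rot90_decomp(1)[OF assms(2), of v])
       (simp add: matrix_vector_right_distrib matrix_vector_mult_scaleR assms(1))
  show "related_field (quot_proj w) (linear_field \<theta> A \<xi>)
      (\<lambda>(t, s). (0, (s *\<^sub>R (A *v rot90 w) + Lambda \<theta> t \<xi>) \<bullet> rot90 w))"
    by (auto simp: related_field_def frechet_derivative_quot_proj Av[symmetric])
qed

lemma ex1_related_left_invariant_field: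
  assumes "norm w = 1"
  shows "\<exists>!F. related_field (quot_proj w) (left_invariant_field \<theta> \<alpha> \<eta>) F"
proof (rule proj_field_eqI(2)[OF surj_quot_proj[OF assms]])
  show "related_field (quot_proj w) (left_invariant_field \<theta> \<alpha> \<eta>)
      (\<lambda>(t, s). (\<alpha>, (rho \<theta> t *v \<eta>) \<bullet> rot90 w))"
    by (auto simp: related_field_def frechet_derivative_quot_proj)
qed

end

theory Submission
  imports Defs
begin

text \<open>
  Let \<open>n = Rw\<close>. Since \<open>A\<close> and \<open>\<theta>\<close> commute and \<open>ker A = \<real>w\<close>, the covector \<open>n\<close> is a common left
  eigenvector: \<open>n \<bullet> Av = lam (n \<bullet> v)\<close> with \<open>lam = tr A\<close>, and \<open>n \<bullet> \<theta>v = \<sigma> (n \<bullet> v)\<close>. So \<open>t\<close> and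
  \<open>s = n \<bullet> v\<close> obey the induced system, and translations along \<open>w\<close> are symmetries of the full
  system. The rank condition enters only through \<open>\<alpha> \<noteq> 0\<close> and the fact that no common left
  eigenvector annihilates \<open>\<alpha>\<xi> + A\<eta>\<close> (lemma \<open>LARC_eigencovector\<close>).

  Suppose \<open>lam \<noteq> 0\<close>. At a fixed \<open>t\<close> and zero control, \<open>s\<close> has exactly one equilibrium. Its distance
  to that equilibrium, scaled by \<open>exp (-\<sigma>t)\<close> and a constant, is a coordinate \<open>y\<close> in which the
  induced system reads \<open>t' = v\<close>, \<open>y' = lam y - v (\<sigma>y + 1)\<close>, where \<open>v = \<alpha>u\<close> ranges over an
  interval \<open>[lo, hi]\<close> around \<open>0\<close>. The equation for \<open>y\<close> is autonomous. Let \<open>K_open\<close> be the set of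
  those \<open>y\<close> whose velocity can be given either sign, and \<open>K_closed\<close> the same with weak
  inequalities. The control set of the induced system consists of the points with \<open>y \<in> K_open\<close> if
  \<open>lam > 0\<close>, and with \<open>y \<in> K_closed\<close> if \<open>lam < 0\<close>; being open or closed is then immediate.

  Controllability (\<open>lifts_K_open\<close>): the extreme rates \<open>lo\<close> and \<open>hi\<close> steer \<open>y\<close> to any value in
  \<open>K_open\<close>, and a constant rate that holds \<open>y\<close> at an equilibrium moves \<open>t\<close> at will. Curves of the
  induced system lift to the group, so only the position along the fibre \<open>\<real>w\<close> remains. At
  \<open>y = 0\<close> and zero control the quotient point stands still while the fibre coordinate drifts, with
  opposite signs over \<open>t = 1\<close> and \<open>t = -1\<close>: this is the rank condition for the second common
  left eigenvector (\<open>fibre_drift\<close>). Waiting at these two places adjusts the fibre coordinate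
  (\<open>transitive_over\<close>). For \<open>lam < 0\<close> the remaining points of \<open>K_closed\<close> are limits of points of
  \<open>K_open\<close>, and the zero control carries them into \<open>K_open\<close>.

  Maximality (\<open>approx_transitive_interior_subset\<close>): each extreme rate \<open>\<nu>\<close> gives a function, a
  multiple of \<open>exp (\<sigma>t) (\<nu> (\<sigma>y + 1) - lam y)\<close>, that satisfies a linear differential inequality
  along all trajectories. At a point outside the control set one of the two has the wrong sign, and
  the inequality then forbids trajectories to cross the starting level in one direction, so
  no approximately transitive set with interior points can leave the control set; uniqueness and
  maximality are both instances of this. It is proved in the quotient only, since projections preserve approximate transitivity
  and interior points (\<open>unique_control_set_fibration\<close>).

  If \<open>lam = 0\<close>, the same lifting argument applies with waiting points \<open>(0, 1)\<close> and \<open>(0, -1)\<close>, and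
  the induced system is controllable: at rest \<open>s\<close> moves with opposite signs over \<open>t = 1\<close> and
  \<open>t = -1\<close>.
\<close>

section \<open>Orbits, symmetries and projections of control systems\<close>

lemma locally_finite_times_Un:
  "locally_finite_times P \<Longrightarrow> locally_finite_times Q \<Longrightarrow> locally_finite_times (P \<union> Q)"
  by (auto simp: locally_finite_times_def Int_Un_distrib2)

lemma locally_finite_times_finite: "finite P \<Longrightarrow> locally_finite_times P"
  by (auto simp: locally_finite_times_def)

lemma locally_finite_times_shift:
  assumes "locally_finite_times P"
  shows "locally_finite_times ((+) c ` P)"
  unfolding locally_finite_times_def
proof (intro allI)
  fix a b
  have "(+) c ` P \<inter> {a..b} \<subseteq> (+) c ` (P \<inter> {a - c..b - c})"
    by auto
  moreover have "finite ((+) c ` (P \<inter> {a - c..b - c}))"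
    using assms by (simp add: locally_finite_times_def)
  ultimately show "finite ((+) c ` P \<inter> {a..b})"
    by (rule finite_subset)
qed

lemma constant_in_controls: "u \<in> \<Omega> \<Longrightarrow> (\<lambda>_. u) \<in> controls \<Omega>"
  by (auto simp: controls_def piecewise_constant_def intro: locally_finite_times_finite)

text \<open>Following a trajectory and then another one is the only way in which trajectories are combined
below; it makes positive orbits transitive without any existence theorem for solutions.\<close>

lemma concat_in_controls:
  assumes "u \<in> controls \<Omega>" "v \<in> controls \<Omega>"
  shows "(\<lambda>s. if s < T then u s else v (s - T)) \<in> controls \<Omega>"
proof -
  from assms obtain P Q where P: "locally_finite_times P"
      "\<And>s t. s \<le> t \<Longrightarrow> {s..t} \<inter> P = {} \<Longrightarrow> u s = u t"
    and Q: "locally_finite_times Q"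
      "\<And>s t. s \<le> t \<Longrightarrow> {s..t} \<inter> Q = {} \<Longrightarrow> v s = v t"
    and r: "range u \<subseteq> \<Omega>" "range v \<subseteq> \<Omega>"
    unfolding controls_def piecewise_constant_def by auto
  let ?w = "\<lambda>s. if s < T then u s else v (s - T)"
  let ?R = "P \<union> (+) T ` Q \<union> {T}"
  have "locally_finite_times ?R"
    by (intro locally_finite_times_Un P(1) locally_finite_times_shift Q(1)
        locally_finite_times_finite) simp
  moreover have "?w s = ?w t" if "s \<le> t" and e: "{s..t} \<inter> ?R = {}" for s t
  proof -
    have "T \<notin> {s..t}"
      using e by blast
    then consider "t < T" | "T < s"
      by force
    then show ?thesis
    proof cases
      case 1
      have "{s..t} \<inter> P = {}"
        using e by blast
      then show ?thesis
        using 1 that(1) P(2)[of s t] by simp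
    next
      case 2
      have "{s - T..t - T} \<inter> Q = {}"
      proof (rule equals0I)
        fix r assume "r \<in> {s - T..t - T} \<inter> Q"
        then have "T + r \<in> {s..t} \<inter> ?R"
          by auto
        with e show False by blast
      qed
      then show ?thesis
        using 2 that(1) Q(2)[of "s - T" "t - T"] by simp
    qed
  qed
  ultimately have "piecewise_constant ?w"
    unfolding piecewise_constant_def by blast
  then show ?thesis
    using r by (auto simp: controls_def)
qed

lemma solution_concat:
  assumes "solution f0 f1 u x \<phi>" "solution f0 f1 v (\<phi> T) \<psi>" "0 \<le> T"
  shows "solution f0 f1 (\<lambda>s. if s < T then u s else v (s - T)) x
    (\<lambda>s. if s \<le> T then \<phi> s else \<psi> (s - T))"
proof -
  from assms obtain P Q where P: "\<phi> 0 = x" "continuous_on UNIV \<phi>" "locally_finite_times P"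
      "\<And>s. s \<notin> P \<Longrightarrow> (\<phi> has_vector_derivative (f0 (\<phi> s) + u s *\<^sub>R f1 (\<phi> s))) (at s)"
    and Q: "\<psi> 0 = \<phi> T" "continuous_on UNIV \<psi>" "locally_finite_times Q"
      "\<And>s. s \<notin> Q \<Longrightarrow> (\<psi> has_vector_derivative (f0 (\<psi> s) + v s *\<^sub>R f1 (\<psi> s))) (at s)"
    unfolding solution_def by blast
  let ?w = "\<lambda>s. if s < T then u s else v (s - T)"
  let ?\<chi> = "\<lambda>s. if s \<le> T then \<phi> s else \<psi> (s - T)"
  let ?R = "P \<union> (+) T ` Q \<union> {T}"
  have "continuous_on ({..T} \<union> {T..}) ?\<chi>"
    by (rule continuous_on_If)
      (auto intro!: continuous_on_compose2[OF Q(2)] continuous_intros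
        continuous_on_subset[OF P(2)] simp: Q(1))
  moreover have "{..T} \<union> {T..} = UNIV"
    by auto
  ultimately have "continuous_on UNIV ?\<chi>"
    by simp
  moreover have "locally_finite_times ?R"
    by (intro locally_finite_times_Un P(3) locally_finite_times_shift Q(3)
        locally_finite_times_finite) simp
  moreover have "(?\<chi> has_vector_derivative (f0 (?\<chi> s) + ?w s *\<^sub>R f1 (?\<chi> s))) (at s)"
    if s: "s \<notin> ?R" for s
  proof -
    consider "s < T" | "T < s"
      using s by force
    then show ?thesis
    proof cases
      case 1
      show ?thesis
        by (rule has_vector_derivative_transform_within_open[where S = "{..<T}" and f = \<phi>])
          (use 1 s P(4) in auto)
    next
      case 2
      have "s - T \<notin> Q"
        using s by (force simp: image_iff)
      then have "(\<psi> has_vector_derivative (f0 (\<psi> (s - T)) + v (s - T) *\<^sub>R f1 (\<psi> (s - T))))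
          (at (s - T))"
        by (rule Q(4))
      then have "((\<psi> \<circ> (\<lambda>s. s - T)) has_vector_derivative
          1 *\<^sub>R (f0 (\<psi> (s - T)) + v (s - T) *\<^sub>R f1 (\<psi> (s - T)))) (at s)"
        by (intro vector_diff_chain_at) (auto intro!: derivative_eq_intros)
      then have d: "((\<lambda>s. \<psi> (s - T)) has_vector_derivative
          (f0 (\<psi> (s - T)) + v (s - T) *\<^sub>R f1 (\<psi> (s - T)))) (at s)"
        by (simp add: o_def)
      show ?thesis
        by (rule has_vector_derivative_transform_within_open[where S = "{T<..}" 
              and f = "\<lambda>s. \<psi> (s - T)"])
          (use 2 d in auto)
    qed
  qed
  ultimately show ?thesis
    unfolding solution_def by (intro conjI exI[of _ ?R]) (auto simp: P(1) assms(3))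
qed

lemma positive_orbitI:
  "S > 0 \<Longrightarrow> u \<in> controls \<Omega> \<Longrightarrow> solution f0 f1 u x \<phi> \<Longrightarrow> y = \<phi> S \<Longrightarrow>
    y \<in> positive_orbit f0 f1 \<Omega> x"
  unfolding positive_orbit_def mem_Collect_eq by (intro exI[of _ \<phi>] exI[of _ S] exI[of _ u]) simp

lemma positive_orbitE:
  assumes "y \<in> positive_orbit f0 f1 \<Omega> x"
  obtains S u \<phi> where "S > 0" "u \<in> controls \<Omega>" "solution f0 f1 u x \<phi>" "y = \<phi> S"
  using assms unfolding positive_orbit_def by auto

lemma positive_orbit_trans:
  assumes "y \<in> positive_orbit f0 f1 \<Omega> x" "z \<in> positive_orbit f0 f1 \<Omega> y"
  shows "z \<in> positive_orbit f0 f1 \<Omega> x"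
proof -
  obtain S u \<phi> where 1: "y = \<phi> S" "S > 0" "u \<in> controls \<Omega>" "solution f0 f1 u x \<phi>"
    using assms(1) by (elim positive_orbitE) (rule that)
  obtain S' v \<psi> where 2: "z = \<psi> S'" "S' > 0" "v \<in> controls \<Omega>" "solution f0 f1 v y \<psi>"
    using assms(2) by (elim positive_orbitE) (rule that)
  show ?thesis
    by (rule positive_orbitI[OF _ concat_in_controls[OF 1(3) 2(3), of S] solution_concat[OF 1(4)],
          of "S + S'"])
      (use 1 2 in auto)
qed

lemma solution_constant_control:
  assumes "\<And>s. (\<phi> has_vector_derivative f0 (\<phi> s) + u *\<^sub>R f1 (\<phi> s)) (at s)"
  shows "solution f0 f1 (\<lambda>_. u) (\<phi> 0) \<phi>"
proof -
  have "continuous_on UNIV \<phi>"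
    by (intro continuous_at_imp_continuous_on ballI has_vector_derivative_continuous[OF assms])
  then show ?thesis
    using assms locally_finite_times_finite[of "{}"] by (auto simp: solution_def)
qed

lemma constant_control_orbit:
  assumes "\<And>s. (\<phi> has_vector_derivative f0 (\<phi> s) + u *\<^sub>R f1 (\<phi> s)) (at s)"
    and "u \<in> \<Omega>" "T > 0"
  shows "\<phi> T \<in> positive_orbit f0 f1 \<Omega> (\<phi> 0)"
  by (rule positive_orbitI[OF assms(3) constant_in_controls[OF assms(2)]
        solution_constant_control[OF assms(1)] refl])

text \<open>The reflexive closure of membership in the positive orbit, so that a steering phase may have
length zero.\<close>

definition reachable ::
  "('a::euclidean_space \<Rightarrow> 'a) \<Rightarrow> ('a \<Rightarrow> 'a) \<Rightarrow> real set \<Rightarrow> 'a \<Rightarrow> 'a \<Rightarrow> bool" where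
  "reachable f0 f1 \<Omega> x y \<longleftrightarrow> y = x \<or> y \<in> positive_orbit f0 f1 \<Omega> x"

lemma reachable_trans:
  "reachable f0 f1 \<Omega> x y \<Longrightarrow> reachable f0 f1 \<Omega> y z \<Longrightarrow> reachable f0 f1 \<Omega> x z"
  unfolding reachable_def using positive_orbit_trans by blast

lemma reachable_positive_orbit:
  "reachable f0 f1 \<Omega> x y \<Longrightarrow> z \<in> positive_orbit f0 f1 \<Omega> y \<Longrightarrow> z \<in> positive_orbit f0 f1 \<Omega> x"
  "y \<in> positive_orbit f0 f1 \<Omega> x \<Longrightarrow> reachable f0 f1 \<Omega> y z \<Longrightarrow> z \<in> positive_orbit f0 f1 \<Omega> x"
  unfolding reachable_def using positive_orbit_trans by blast+

lemma constant_control_reachable: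
  assumes "\<And>s. (\<phi> has_vector_derivative f0 (\<phi> s) + u *\<^sub>R f1 (\<phi> s)) (at s)"
    and "u \<in> \<Omega>" "T \<ge> 0"
  shows "reachable f0 f1 \<Omega> (\<phi> 0) (\<phi> T)"
  using constant_control_orbit[OF assms(1,2), of T] assms(3)
  unfolding reachable_def by (cases "T = 0") auto

lemma solution_translate:
  assumes "\<And>x. f0 (x + c) = f0 x" "\<And>x. f1 (x + c) = f1 x" "solution f0 f1 u x \<phi>"
  shows "solution f0 f1 u (x + c) (\<lambda>s. \<phi> s + c)"
proof -
  from assms(3) obtain P where P: "\<phi> 0 = x" "continuous_on UNIV \<phi>" "locally_finite_times P"
      "\<And>s. s \<notin> P \<Longrightarrow> (\<phi> has_vector_derivative (f0 (\<phi> s) + u s *\<^sub>R f1 (\<phi> s))) (at s)"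
    unfolding solution_def by blast
  have "continuous_on UNIV (\<lambda>s. \<phi> s + c)"
    by (intro continuous_intros P(2))
  then show ?thesis
    using P unfolding solution_def
    by (intro conjI exI[of _ P]) (simp_all add: assms(1,2) has_vector_derivative_add_const)
qed

lemma positive_orbit_translate:
  assumes "\<And>x. f0 (x + c) = f0 x" "\<And>x. f1 (x + c) = f1 x" "y \<in> positive_orbit f0 f1 \<Omega> x"
  shows "y + c \<in> positive_orbit f0 f1 \<Omega> (x + c)"
proof -
  from assms(3) obtain S u \<phi>
    where "S > 0" "u \<in> controls \<Omega>" "solution f0 f1 u x \<phi>" "y = \<phi> S"
    by (rule positive_orbitE)
  then show ?thesis
    by (intro positive_orbitI[OF _ _ solution_translate[of f0 c f1, OF assms(1,2)]]) auto
qed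

lemma reachable_translate:
  assumes "\<And>x. f0 (x + c) = f0 x" "\<And>x. f1 (x + c) = f1 x" "reachable f0 f1 \<Omega> x y"
  shows "reachable f0 f1 \<Omega> (x + c) (y + c)"
  using assms(3) positive_orbit_translate[of f0 c f1, OF assms(1,2)] unfolding reachable_def by blast

lemma solution_project:
  assumes p: "bounded_linear p" and rel: "\<And>x. F0 (p x) = p (f0 x)" "\<And>x. F1 (p x) = p (f1 x)"
    and "solution f0 f1 u x \<phi>"
  shows "solution F0 F1 u (p x) (\<lambda>s. p (\<phi> s))"
proof -
  interpret bounded_linear p by (rule p)
  from assms(4) obtain P where P: "\<phi> 0 = x" "continuous_on UNIV \<phi>" "locally_finite_times P"
      "\<And>s. s \<notin> P \<Longrightarrow> (\<phi> has_vector_derivative (f0 (\<phi> s) + u s *\<^sub>R f1 (\<phi> s))) (at s)"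
    unfolding solution_def by blast
  have "((\<lambda>s. p (\<phi> s)) has_vector_derivative (F0 (p (\<phi> s)) + u s *\<^sub>R F1 (p (\<phi> s)))) (at s)"
    if "s \<notin> P" for s
    using has_vector_derivative[OF P(4)[OF that]] by (simp add: rel add scaleR)
  then show ?thesis
    using P(1,3) continuous_on[OF P(2)] unfolding solution_def
    by (intro conjI exI[of _ P]) simp_all
qed

lemma approx_transitive_project:
  assumes p: "bounded_linear p" and rel: "\<And>x. F0 (p x) = p (f0 x)" "\<And>x. F1 (p x) = p (f1 x)"
    and "approx_transitive f0 f1 \<Omega> D"
  shows "approx_transitive F0 F1 \<Omega> (p ` D)"
  unfolding approx_transitive_def
proof (intro ballI)
  fix y assume "y \<in> p ` D"
  then obtain x where x: "x \<in> D" "y = p x" by blast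
  have "p ` positive_orbit f0 f1 \<Omega> x \<subseteq> positive_orbit F0 F1 \<Omega> y"
  proof
    fix z assume "z \<in> p ` positive_orbit f0 f1 \<Omega> x"
    then obtain z' where z': "z' \<in> positive_orbit f0 f1 \<Omega> x" "z = p z'" by blast
    from z'(1) obtain S u \<phi>
      where "S > 0" "u \<in> controls \<Omega>" "solution f0 f1 u x \<phi>" "z' = \<phi> S"
      by (rule positive_orbitE)
    then show "z \<in> positive_orbit F0 F1 \<Omega> y"
      unfolding z'(2) x(2)
      by (intro positive_orbitI[OF _ _ solution_project[of p F0 f0 F1 f1, OF p rel]]) auto
  qed
  moreover have "p ` closure (positive_orbit f0 f1 \<Omega> x) \<subseteq> closure (p ` positive_orbit f0 f1 \<Omega> x)"
    by (intro image_closure_subset linear_continuous_on p closed_closure closure_subset)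
  moreover have "p ` D \<subseteq> p ` closure (positive_orbit f0 f1 \<Omega> x)"
    using assms(4) x(1) by (auto simp: approx_transitive_def)
  ultimately show "p ` D \<subseteq> closure (positive_orbit F0 F1 \<Omega> y)"
    using closure_mono by (meson order_trans)
qed

lemma weakly_invariant_project:
  assumes p: "bounded_linear p" and rel: "\<And>x. F0 (p x) = p (f0 x)" "\<And>x. F1 (p x) = p (f1 x)"
    and "weakly_invariant f0 f1 \<Omega> D"
  shows "weakly_invariant F0 F1 \<Omega> (p ` D)"
  unfolding weakly_invariant_def
proof (intro ballI)
  fix y assume "y \<in> p ` D"
  then obtain x where x: "x \<in> D" "y = p x" by blast
  then obtain u \<phi> where "u \<in> controls \<Omega>" "solution f0 f1 u x \<phi>" "\<phi> ` {0..} \<subseteq> D"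
    using assms(4) unfolding weakly_invariant_def by blast
  then show "\<exists>u\<in>controls \<Omega>. \<exists>\<phi>. solution F0 F1 u y \<phi> \<and> \<phi> ` {0..} \<subseteq> p ` D"
    unfolding x(2)
    by (intro bexI[of _ u] exI[of _ "\<lambda>s. p (\<phi> s)"] conjI
        solution_project[of p F0 f0 F1 f1, OF p rel]) auto
qed

text \<open>Any control set with interior points is itself approximately transitive, hence contained in
\<open>C\<close>, hence equal to \<open>C\<close> by its own maximality. The same hypothesis makes \<open>C\<close> maximal.\<close>

lemma unique_control_setI:
  assumes "weakly_invariant f0 f1 \<Omega> C" "approx_transitive f0 f1 \<Omega> C" "interior C \<noteq> {}"
    and "\<And>D. approx_transitive f0 f1 \<Omega> D \<Longrightarrow> interior D \<noteq> {} \<Longrightarrow> D \<subseteq> C"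
  shows "unique_control_set_with_interior f0 f1 \<Omega> C"
proof -
  have "D = C" if "C \<subseteq> D" "approx_transitive f0 f1 \<Omega> D" for D
    using that assms(3,4) interior_mono[of C D] by blast
  moreover have "D = C" if "control_set f0 f1 \<Omega> D" "interior D \<noteq> {}" for D
  proof -
    have "D \<subseteq> C"
      using assms(4) that unfolding control_set_def by simp
    moreover have "\<forall>D'. D \<subseteq> D' \<and> weakly_invariant f0 f1 \<Omega> D' \<and> approx_transitive f0 f1 \<Omega> D' \<longrightarrow> D' = D"
      using that(1) unfolding control_set_def by simp
    ultimately show ?thesis
      using assms(1,2) by blast
  qed
  ultimately show ?thesis
    using assms unfolding unique_control_set_with_interior_def control_set_def by blast
qed

text \<open>The bound on approximately transitive sets has to be known for the base only: the image of such
a set under the open map \<open>p\<close> is again approximately transitive with interior points. Conversely,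
weak invariance and approximate transitivity of \<open>C\<close> come down from \<open>p -` C\<close>.\<close>

lemma unique_control_set_fibration:
  fixes f0 f1 :: "'a::euclidean_space \<Rightarrow> 'a" and F0 F1 :: "'b::euclidean_space \<Rightarrow> 'b"
  assumes p: "bounded_linear p" and surj: "surj p"
    and rel: "\<And>x. F0 (p x) = p (f0 x)" "\<And>x. F1 (p x) = p (f1 x)"
    and wi: "weakly_invariant f0 f1 \<Omega> (p -` C)" and at: "approx_transitive f0 f1 \<Omega> (p -` C)"
    and int: "interior C \<noteq> {}"
    and max: "\<And>D. approx_transitive F0 F1 \<Omega> D \<Longrightarrow> interior D \<noteq> {} \<Longrightarrow> D \<subseteq> C"
  shows "unique_control_set_with_interior f0 f1 \<Omega> (p -` C)"
    and "unique_control_set_with_interior F0 F1 \<Omega> C"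
proof -
  have lin: "linear p" using p by (rule bounded_linear.linear)
  have img: "p ` (p -` C) = C" using surj by (rule surj_image_vimage_eq)
  show "unique_control_set_with_interior F0 F1 \<Omega> C"
    using weakly_invariant_project[of p F0 f0 F1 f1, OF p rel wi]
      approx_transitive_project[of p F0 f0 F1 f1, OF p rel at] int max
    unfolding img by (intro unique_control_setI)
  have "open (p -` interior C)"
    using p by (intro open_vimage) (auto intro: linear_continuous_on)
  then have "p -` interior C \<subseteq> interior (p -` C)"
    by (intro interior_maximal) (auto dest: interior_subset[THEN subsetD])
  moreover have "p -` interior C \<noteq> {}"
    using int surj by (metis ex_in_conv surjD vimageI2)
  ultimately have "interior (p -` C) \<noteq> {}" by blast
  moreover have "D \<subseteq> p -` C" if "approx_transitive f0 f1 \<Omega> D" "interior D \<noteq> {}" for D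
  proof -
    have "open (p ` interior D)"
      using lin surj by (intro open_surjective_linear_image) auto
    then have "p ` interior D \<subseteq> interior (p ` D)"
      by (intro interior_maximal image_mono interior_subset)
    then show ?thesis
      using max[OF approx_transitive_project[of p F0 f0 F1 f1, OF p rel that(1)]] that(2) by blast
  qed
  ultimately show "unique_control_set_with_interior f0 f1 \<Omega> (p -` C)"
    using wi at by (intro unique_control_setI)
qed

text \<open>Only finitely many switching times lie in \<open>{0..T}\<close>, so the fundamental theorem of calculus still
applies to a continuous function that fails to be differentiable there.\<close>

lemma nondecreasing_off_locally_finite:
  fixes g :: "real \<Rightarrow> real"
  assumes "continuous_on UNIV g" "locally_finite_times P"
    and d: "\<And>s. s \<notin> P \<Longrightarrow> (g has_real_derivative g' s) (at s)"
    and nonneg: "\<And>s. s \<notin> P \<Longrightarrow> 0 \<le> g' s" and "0 \<le> T"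
  shows "g 0 \<le> g T"
proof -
  let ?h = "\<lambda>s. if s \<in> P then 0 else g' s"
  have "(?h has_integral (g T - g 0)) {0..T}"
  proof (rule fundamental_theorem_of_calculus_interior_strong)
    show "finite (P \<inter> {0..T})"
      using assms(2) by (simp add: locally_finite_times_def)
    fix s assume "s \<in> {0<..<T} - P \<inter> {0..T}"
    then have "s \<notin> P" by auto
    then show "(g has_vector_derivative ?h s) (at s)"
      using d[of s] by (simp add: has_real_derivative_iff_has_vector_derivative)
  qed (use assms(1,5) continuous_on_subset in auto)
  then have "0 \<le> g T - g 0"
    by (rule has_integral_nonneg) (simp add: nonneg)
  then show ?thesis by simp
qed

section \<open>The one-parameter group and its integrals\<close>

lemma summable_mat_exp:
  fixes M :: "real^'n^'n"
  shows "summable (\<lambda>k. (1 / fact k) *\<^sub>R ((**) M ^^ k) (mat 1))"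
proof -
  have rdistrib: "(A + B) ** C = A ** C + B ** C" for A B C :: "real^'n^'n"
    by (simp add: matrix_matrix_mult_def vec_eq_iff distrib_right sum.distrib)
  have "bilinear ((**) :: real^'n^'n \<Rightarrow> real^'n^'n \<Rightarrow> real^'n^'n)"
    unfolding bilinear_def
  proof (intro conjI allI linearI)
    fix c :: real and A B :: "real^'n^'n"
    show "A ** (c *\<^sub>R B) = c *\<^sub>R (A ** B)"
      by (metis matrix_scalar_ac scalar_matrix_assoc)
    show "(c *\<^sub>R A) ** B = c *\<^sub>R (A ** B)"
      by (simp only: scalar_matrix_assoc)
  qed (simp_all only: matrix_add_ldistrib rdistrib)
  then have "bounded_bilinear ((**) :: real^'n^'n \<Rightarrow> real^'n^'n \<Rightarrow> real^'n^'n)"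
    by (rule bilinear_conv_bounded_bilinear[THEN iffD1])
  from bounded_bilinear.pos_bounded[OF this]
  obtain K where "K > 0" and "\<forall>(A :: real^'n^'n) (B :: real^'n^'n).
      norm (A ** B) \<le> norm A * norm B * K"
    by blast
  then have K: "K > 0" "norm (A ** B) \<le> norm A * norm B * K" for A B :: "real^'n^'n"
    by simp_all
  have bnd: "norm (((**) M ^^ k) (mat 1)) \<le> (norm M * K) ^ k * norm (mat 1 :: real^'n^'n)" for k
  proof (induction k)
    case (Suc k)
    have "norm (((**) M ^^ Suc k) (mat 1)) \<le> norm M * K * norm (((**) M ^^ k) (mat 1))"
      using K(2)[of M "((**) M ^^ k) (mat 1)"] by (simp add: mult_ac)
    also have "\<dots> \<le> norm M * K * ((norm M * K) ^ k * norm (mat 1 :: real^'n^'n))"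
      using K(1) by (intro mult_left_mono Suc) auto
    finally show ?case by (simp add: mult_ac)
  qed simp
  have "summable (\<lambda>k. (inverse (fact k) * (norm M * K) ^ k) * norm (mat 1 :: real^'n^'n))"
    using summable_exp[of "norm M * K"] by (intro summable_mult2)
  then show ?thesis
  proof (rule summable_comparison_test'[where N = 0])
    fix k
    show "norm ((1 / fact k) *\<^sub>R ((**) M ^^ k) (mat 1)) \<le>
        inverse (fact k) * (norm M * K) ^ k * norm (mat 1 :: real^'n^'n)"
      using mult_left_mono[OF bnd[of k], of "inverse (fact k)"]
      by (simp add: inverse_eq_divide mult.assoc)
  qed
qed

lemma matrix_power_scaleR:
  fixes M :: "real^'n^'n"
  shows "((**) (t *\<^sub>R M) ^^ k) (mat 1) = t ^ k *\<^sub>R ((**) M ^^ k) (mat 1)"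
proof (induction k)
  case (Suc k)
  then show ?case
    by (simp add: scalar_matrix_assoc[symmetric]) (simp add: matrix_scalar_ac scalar_matrix_assoc[symmetric])
qed simp

lemma matrix_power_mult_vector:
  fixes M :: "real^'n^'n"
  shows "((**) M ^^ k) (mat 1) *v x = ((*v) M ^^ k) x"
  by (induction k) (simp_all add: matrix_vector_mul_assoc[symmetric])

lemma rho_vector_sums:
  "(\<lambda>k. (t ^ k / fact k) *\<^sub>R ((*v) \<theta> ^^ k) x) sums (rho \<theta> t *v x)"
proof -
  have "bounded_linear (\<lambda>M :: real^2^2. M *v x)"
    by (intro linear_conv_bounded_linear[THEN iffD1] linearI)
      (simp_all add: matrix_vector_mult_add_rdistrib scaleR_matrix_vector_assoc)
  moreover have "(\<lambda>k. (1 / fact k) *\<^sub>R ((**) (t *\<^sub>R \<theta>) ^^ k) (mat 1)) sums rho \<theta> t"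
    unfolding rho_def mat_exp_def by (intro summable_sums summable_mat_exp)
  ultimately have "(\<lambda>k. ((1 / fact k) *\<^sub>R ((**) (t *\<^sub>R \<theta>) ^^ k) (mat 1)) *v x) sums (rho \<theta> t *v x)"
    by (rule bounded_linear.sums)
  then show ?thesis
    by (simp add: matrix_power_scaleR matrix_power_mult_vector
        scaleR_matrix_vector_assoc[symmetric])
qed

text \<open>Each coordinate of \<open>rho \<theta> t *v x\<close> is a real power series in \<open>t\<close> that converges everywhere, and
is therefore differentiated term by term.\<close>

lemma has_vector_derivative_rho:
  "((\<lambda>t. rho \<theta> t *v x) has_vector_derivative rho \<theta> t *v (\<theta> *v x)) (at t)"
  unfolding has_vector_derivative_def
proof (subst has_derivative_componentwise_within, intro ballI)
  fix i :: "real^2" assume "i \<in> Basis"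
  define c where "c = (\<lambda>k. (((*v) \<theta> ^^ k) x \<bullet> i) / fact k)"
  have s: "(\<lambda>k. c k * r ^ k) sums ((rho \<theta> r *v x) \<bullet> i)" for r
    using bounded_linear.sums[OF bounded_linear_inner_left rho_vector_sums[of r \<theta> x], of i]
    by (simp add: c_def mult.commute)
  have "diffs c k = (((*v) \<theta> ^^ k) (\<theta> *v x) \<bullet> i) / fact k" for k
    by (simp add: diffs_def c_def funpow_swap1 divide_simps)
  then have "(\<lambda>k. diffs c k * t ^ k) sums ((rho \<theta> t *v (\<theta> *v x)) \<bullet> i)"
    using bounded_linear.sums[OF bounded_linear_inner_left rho_vector_sums[of t \<theta> "\<theta> *v x"], of i]
    by (simp add: mult.commute)
  moreover have "((\<lambda>r. \<Sum>k. c k * r ^ k) has_field_derivative (\<Sum>k. diffs c k * t ^ k)) (at t)"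
    using s by (intro termdiffs_strong_converges_everywhere) (auto simp: sums_iff)
  ultimately have "((\<lambda>r. (rho \<theta> r *v x) \<bullet> i) has_field_derivative
      ((rho \<theta> t *v (\<theta> *v x)) \<bullet> i)) (at t)"
    using s by (simp add: sums_iff)
  then show "((\<lambda>r. (rho \<theta> r *v x) \<bullet> i) has_derivative
      (\<lambda>h. h *\<^sub>R (rho \<theta> t *v (\<theta> *v x)) \<bullet> i)) (at t)"
    by (rule has_derivative_eq_rhs[OF has_field_derivative_imp_has_derivative]) auto
qed

lemma continuous_rho: "continuous_on S (\<lambda>t. rho \<theta> t *v x)"
  by (intro continuous_at_imp_continuous_on ballI
      has_vector_derivative_continuous[OF has_vector_derivative_rho])

lemma rho_commute:
  assumes "A ** \<theta> = \<theta> ** A"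
  shows "A *v (rho \<theta> t *v x) = rho \<theta> t *v (A *v x)"
proof -
  have "A *v (((*v) \<theta> ^^ k) x) = ((*v) \<theta> ^^ k) (A *v x)" for k
    by (induction k) (simp_all add: matrix_vector_mul_assoc assms,
        simp add: matrix_vector_mul_assoc[symmetric])
  moreover have "(\<lambda>k. A *v ((t ^ k / fact k) *\<^sub>R ((*v) \<theta> ^^ k) x)) sums (A *v (rho \<theta> t *v x))"
    by (intro bounded_linear.sums[OF matrix_vector_mul_bounded_linear] rho_vector_sums)
  ultimately show ?thesis
    using rho_vector_sums[of t \<theta> "A *v x"] sums_unique2
    by (fastforce simp: matrix_vector_mult_scaleR)
qed

lemma inner_rho_eigen:
  assumes "\<And>v. n \<bullet> (\<theta> *v v) = \<sigma> * (n \<bullet> v)"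
  shows "n \<bullet> (rho \<theta> t *v x) = exp (\<sigma> * t) * (n \<bullet> x)"
proof -
  have "n \<bullet> (((*v) \<theta> ^^ k) x) = \<sigma> ^ k * (n \<bullet> x)" for k
    by (induction k) (simp_all add: assms)
  then have "(\<lambda>k. (\<sigma> * t) ^ k /\<^sub>R fact k * (n \<bullet> x)) sums (n \<bullet> (rho \<theta> t *v x))"
    using bounded_linear.sums[OF bounded_linear_inner_right rho_vector_sums[of t \<theta> x], of n]
    by (simp add: field_simps power_mult_distrib)
  moreover have "(\<lambda>k. (\<sigma> * t) ^ k /\<^sub>R fact k * (n \<bullet> x)) sums (exp (\<sigma> * t) * (n \<bullet> x))"
    by (intro sums_mult2 exp_converges)
  ultimately show ?thesis
    by (rule sums_unique2)
qed

lemma has_vector_derivative_integral_0: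
  fixes f :: "real \<Rightarrow> 'a::euclidean_space"
  assumes "continuous_on UNIV f"
  shows "((\<lambda>t. LBINT s=ereal 0..ereal t. f s) has_vector_derivative f t) (at t)"
proof -
  let ?a = "min 0 t - 1" and ?b = "max 0 t + 1"
  have "((\<lambda>t. LBINT s=ereal 0..ereal t. f s) has_vector_derivative f t) (at t within {?a..?b})"
    using interval_integral_FTC2[of ?a 0 ?b f t] continuous_on_subset[OF assms]
    by (simp add: zero_ereal_def)
  then show ?thesis
    by (subst (asm) at_within_interior) auto
qed

lemma has_vector_derivative_Lambda:
  "((\<lambda>t. Lambda \<theta> t x) has_vector_derivative rho \<theta> t *v x) (at t)"
  unfolding Lambda_def by (intro has_vector_derivative_integral_0 continuous_rho)

lemma Lambda_0: "Lambda \<theta> 0 x = 0"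
  by (simp add: Lambda_def)

lemma eq_if_same_vector_derivative:
  fixes f g :: "real \<Rightarrow> 'a::real_normed_vector"
  assumes "\<And>t. (f has_vector_derivative h t) (at t)" "\<And>t. (g has_vector_derivative h t) (at t)"
    and "f 0 = g 0"
  shows "f t = g t"
proof -
  have "((\<lambda>t. f t - g t) has_derivative (\<lambda>h. 0)) (at t within UNIV)" for t
    using has_vector_derivative_diff[OF assms(1,2), of t]
    by (simp add: has_vector_derivative_def)
  then have "\<exists>c. \<forall>t\<in>UNIV. f t - g t = c"
    by (intro has_derivative_zero_constant) auto
  then show ?thesis using assms(3) by (metis UNIV_I eq_iff_diff_eq_0)
qed

lemma Lambda_commute:
  assumes "A ** \<theta> = \<theta> ** A"
  shows "A *v Lambda \<theta> t x = Lambda \<theta> t (A *v x)"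
proof (rule eq_if_same_vector_derivative[where h = "\<lambda>t. A *v (rho \<theta> t *v x)"
      and f = "\<lambda>t. A *v Lambda \<theta> t x"])
  show "((\<lambda>t. A *v Lambda \<theta> t x) has_vector_derivative A *v (rho \<theta> t *v x)) (at t)" for t
    by (rule bounded_linear.has_vector_derivative[OF matrix_vector_mul_bounded_linear
          has_vector_derivative_Lambda])
  show "((\<lambda>t. Lambda \<theta> t (A *v x)) has_vector_derivative A *v (rho \<theta> t *v x)) (at t)" for t
    unfolding rho_commute[OF assms] by (rule has_vector_derivative_Lambda)
qed (simp add: Lambda_0)

text \<open>The integral of \<open>exp (\<sigma>r)\<close> over \<open>r\<close> from \<open>0\<close> to \<open>t\<close>.\<close>

definition exp_primitive :: "real \<Rightarrow> real \<Rightarrow> real" where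
  "exp_primitive \<sigma> t = (if \<sigma> = 0 then t else (exp (\<sigma> * t) - 1) / \<sigma>)"

lemma exp_primitive_0 [simp]: "exp_primitive \<sigma> 0 = 0"
  by (simp add: exp_primitive_def)

lemma exp_primitive_eq: "\<sigma> * exp_primitive \<sigma> t = exp (\<sigma> * t) - 1"
  by (simp add: exp_primitive_def)

lemma has_real_derivative_exp_primitive [derivative_intros]:
  assumes "(f has_real_derivative f') (at x within S)"
  shows "((\<lambda>x. exp_primitive \<sigma> (f x)) has_real_derivative exp (\<sigma> * f x) * f') (at x within S)"
  using assms unfolding exp_primitive_def
  by (cases "\<sigma> = 0") (auto intro!: derivative_eq_intros)

lemma continuous_on_exp_primitive [continuous_intros]:
  "continuous_on S f \<Longrightarrow> continuous_on S (\<lambda>x. exp_primitive \<sigma> (f x))"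
  unfolding exp_primitive_def by (cases "\<sigma> = 0") (auto intro!: continuous_intros)

lemma exp_primitive_sign:
  shows "0 < t \<Longrightarrow> 0 < exp_primitive \<sigma> t" and "t < 0 \<Longrightarrow> exp_primitive \<sigma> t < 0"
  by (auto simp: exp_primitive_def zero_less_divide_iff divide_less_0_iff mult_less_0_iff
      zero_less_mult_iff)

text \<open>The range of \<open>exp_primitive m\<close> on nonnegative times is all of \<open>[0, \<infinity>)\<close> for \<open>m \<ge> 0\<close> and
\<open>[0, -1/m)\<close> for \<open>m < 0\<close>; the second hypothesis covers both cases.\<close>

lemma exp_primitive_onto:
  assumes "0 \<le> r" "0 < 1 + m * r"
  obtains T where "0 \<le> T" "exp_primitive m T = r"
proof (cases "m = 0")
  case True
  then show ?thesis using that[of r] assms by (simp add: exp_primitive_def)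
next
  case False
  have "0 \<le> ln (1 + m * r) / m"
    using False assms by (cases "m > 0") (auto simp: zero_le_divide_iff mult_nonpos_nonneg)
  then show ?thesis
    using that[of "ln (1 + m * r) / m"] False assms by (simp add: exp_primitive_def)
qed

lemma inner_Lambda_eigen:
  assumes "\<And>v. n \<bullet> (\<theta> *v v) = \<sigma> * (n \<bullet> v)"
  shows "n \<bullet> Lambda \<theta> t x = exp_primitive \<sigma> t * (n \<bullet> x)"
proof (rule eq_if_same_vector_derivative[where h = "\<lambda>t. exp (\<sigma> * t) * (n \<bullet> x)"
      and f = "\<lambda>t. n \<bullet> Lambda \<theta> t x"])
  show "((\<lambda>t. n \<bullet> Lambda \<theta> t x) has_vector_derivative exp (\<sigma> * t) * (n \<bullet> x)) (at t)" for t
    using bounded_linear.has_vector_derivative[OF bounded_linear_inner_right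
          has_vector_derivative_Lambda[of \<theta> x t], of n]
    by (simp add: inner_rho_eigen[OF assms])
  show "((\<lambda>t. exp_primitive \<sigma> t * (n \<bullet> x)) has_vector_derivative exp (\<sigma> * t) * (n \<bullet> x)) (at t)" for t
    unfolding has_real_derivative_iff_has_vector_derivative[symmetric]
    by (auto intro!: derivative_eq_intros)
qed (simp add: Lambda_0)

section \<open>What the Lie algebra rank condition says about eigencovectors\<close>

text \<open>A family of vector fields that contains both fields of the system and is closed under Lie
brackets when \<open>A\<close> commutes with \<open>\<theta>\<close>. All its members are differentiable, so brackets formed with
\<open>frechet_derivative\<close> are meaningful and can be computed.\<close>

definition affine_field ::
  "real^2^2 \<Rightarrow> real^2^2 \<Rightarrow> real \<Rightarrow> real \<Rightarrow> real^2 \<Rightarrow> real^2 \<Rightarrow> real \<times> (real^2) \<Rightarrow> real \<times> (real^2)" where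
  "affine_field \<theta> A a \<beta> p q =
     (\<lambda>x. (a, \<beta> *\<^sub>R (A *v snd x) + Lambda \<theta> (fst x) p + rho \<theta> (fst x) *v q))"

lemma linear_field_eq_affine: "linear_field \<theta> A \<xi> = affine_field \<theta> A 0 1 \<xi> 0"
  by (auto simp: affine_field_def fun_eq_iff)

lemma left_invariant_field_eq_affine: "left_invariant_field \<theta> \<alpha> \<eta> = affine_field \<theta> A \<alpha> 0 0 \<eta>"
proof -
  have "Lambda \<theta> t 0 = 0" for t
    by (simp add: Lambda_def)
  then show ?thesis
    by (auto simp: affine_field_def fun_eq_iff)
qed

lemma Lambda_add: "Lambda \<theta> t (x + y) = Lambda \<theta> t x + Lambda \<theta> t y"
proof (rule eq_if_same_vector_derivative[where f = "\<lambda>t. Lambda \<theta> t (x + y)"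
      and h = "\<lambda>t. rho \<theta> t *v x + rho \<theta> t *v y"])
  show "((\<lambda>t. Lambda \<theta> t (x + y)) has_vector_derivative rho \<theta> t *v x + rho \<theta> t *v y) (at t)" for t
    using has_vector_derivative_Lambda[of \<theta> "x + y" t] by (simp add: matrix_vector_right_distrib)
qed (auto intro!: derivative_eq_intros has_vector_derivative_Lambda simp: Lambda_0)

lemma Lambda_scale: "Lambda \<theta> t (c *\<^sub>R x) = c *\<^sub>R Lambda \<theta> t x"
proof (rule eq_if_same_vector_derivative[where f = "\<lambda>t. Lambda \<theta> t (c *\<^sub>R x)"
      and h = "\<lambda>t. c *\<^sub>R (rho \<theta> t *v x)"])
  show "((\<lambda>t. Lambda \<theta> t (c *\<^sub>R x)) has_vector_derivative c *\<^sub>R (rho \<theta> t *v x)) (at t)" for t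
    using has_vector_derivative_Lambda[of \<theta> "c *\<^sub>R x" t] by (simp add: matrix_vector_mult_scaleR)
  show "((\<lambda>t. c *\<^sub>R Lambda \<theta> t x) has_vector_derivative c *\<^sub>R (rho \<theta> t *v x)) (at t)" for t
    by (rule bounded_linear.has_vector_derivative[OF bounded_linear_scaleR_right
          has_vector_derivative_Lambda])
qed (simp add: Lambda_0)

lemma Lambda_diff: "Lambda \<theta> t (x - y) = Lambda \<theta> t x - Lambda \<theta> t y"
proof -
  have "Lambda \<theta> t (x - y) + Lambda \<theta> t y = Lambda \<theta> t x"
    by (simp flip: Lambda_add)
  then show ?thesis by (simp add: algebra_simps)
qed

lemma has_derivative_affine_field:
  "(affine_field \<theta> A a \<beta> p q has_derivative
     (\<lambda>d. (0, \<beta> *\<^sub>R (A *v snd d) + fst d *\<^sub>R (rho \<theta> (fst x) *v (p + \<theta> *v q))))) (at x)"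
proof -
  have 1: "((\<lambda>x :: real \<times> (real^2). Lambda \<theta> (fst x) p) has_derivative
      (\<lambda>d. fst d *\<^sub>R (rho \<theta> (fst x) *v p))) (at x)"
    using has_derivative_compose[OF has_derivative_fst[OF has_derivative_ident]
        has_vector_derivative_Lambda[unfolded has_vector_derivative_def]] .
  have 2: "((\<lambda>x :: real \<times> (real^2). rho \<theta> (fst x) *v q) has_derivative
      (\<lambda>d. fst d *\<^sub>R (rho \<theta> (fst x) *v (\<theta> *v q)))) (at x)"
    using has_derivative_compose[OF has_derivative_fst[OF has_derivative_ident]
        has_vector_derivative_rho[unfolded has_vector_derivative_def]] .
  have 3: "((\<lambda>x :: real \<times> (real^2). A *v snd x) has_derivative (\<lambda>d. A *v snd d)) (at x)"
    by (rule bounded_linear.has_derivative[OF matrix_vector_mul_bounded_linear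
          has_derivative_snd[OF has_derivative_ident]])
  show ?thesis
    unfolding affine_field_def
    by (rule has_derivative_eq_rhs, (rule has_derivative_Pair has_derivative_const
          has_derivative_add has_derivative_scaleR_right 1 2 3)+)
       (simp add: matrix_vector_right_distrib scaleR_add_right add.assoc)
qed

lemma lie_bracket_affine_field:
  assumes "A ** \<theta> = \<theta> ** A"
  shows "lie_bracket (affine_field \<theta> A a \<beta> p q) (affine_field \<theta> A a' \<beta>' p' q') =
    affine_field \<theta> A 0 0 (A *v (\<beta>' *\<^sub>R p - \<beta> *\<^sub>R p'))
      (A *v (\<beta>' *\<^sub>R q - \<beta> *\<^sub>R q') + (a *\<^sub>R p' - a' *\<^sub>R p) + \<theta> *v (a *\<^sub>R q' - a' *\<^sub>R q))"
  unfolding lie_bracket_def frechet_derivative_at[OF has_derivative_affine_field, symmetric]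
  by (simp add: affine_field_def fun_eq_iff matrix_vector_right_distrib
      matrix_vector_mult_diff_distrib matrix_vector_mult_scaleR scaleR_diff_right scaleR_add_right
      rho_commute[OF assms] Lambda_commute[OF assms] Lambda_diff Lambda_scale)

text \<open>Induction over the generated Lie algebra, in terms of the four parameters of \<open>affine_field\<close>.\<close>

lemma generated_lie_algebra_affine:
  assumes comm: "A ** \<theta> = \<theta> ** A"
    and "I 0 1 \<xi> 0" "I \<alpha> 0 0 \<eta>" "I 0 0 0 0"
    and "\<And>a \<beta> p q a' \<beta>' p' q'. I a \<beta> p q \<Longrightarrow> I a' \<beta>' p' q' \<Longrightarrow> I (a + a') (\<beta> + \<beta>') (p + p') (q + q')"
    and "\<And>a \<beta> p q c. I a \<beta> p q \<Longrightarrow> I (c * a) (c * \<beta>) (c *\<^sub>R p) (c *\<^sub>R q)"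
    and "\<And>a \<beta> p q a' \<beta>' p' q'. I a \<beta> p q \<Longrightarrow> I a' \<beta>' p' q' \<Longrightarrow>
      I 0 0 (A *v (\<beta>' *\<^sub>R p - \<beta> *\<^sub>R p'))
        (A *v (\<beta>' *\<^sub>R q - \<beta> *\<^sub>R q') + (a *\<^sub>R p' - a' *\<^sub>R p) + \<theta> *v (a *\<^sub>R q' - a' *\<^sub>R q))"
    and "Z \<in> generated_lie_algebra {linear_field \<theta> A \<xi>, left_invariant_field \<theta> \<alpha> \<eta>}"
  shows "\<exists>a \<beta> p q. I a \<beta> p q \<and> Z = affine_field \<theta> A a \<beta> p q"
proof -
  have S: "\<exists>a \<beta> p q. I a \<beta> p q \<and> Z = affine_field \<theta> A a \<beta> p q"
    if "I a \<beta> p q" "Z = affine_field \<theta> A a \<beta> p q" for a \<beta> p q Z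
    using that by blast
  show ?thesis
    using assms(8)
  proof induction
    case (base Z)
    then consider "Z = affine_field \<theta> A 0 1 \<xi> 0" | "Z = affine_field \<theta> A \<alpha> 0 0 \<eta>"
      using linear_field_eq_affine[of \<theta> A \<xi>] left_invariant_field_eq_affine[of \<theta> \<alpha> \<eta> A]
      by auto
    then show ?case
    proof cases
      case 1
      show ?thesis by (rule S[OF assms(2) 1])
    next
      case 2
      show ?thesis by (rule S[OF assms(3) 2])
    qed
  next
    case zero
    have "(\<lambda>x. 0) = affine_field \<theta> A 0 0 0 0"
      by (simp add: affine_field_def fun_eq_iff Lambda_def zero_prod_def)
    from S[OF assms(4) this] show ?case .
  next
    case (add Z Z')
    then obtain a \<beta> p q a' \<beta>' p' q'
      where Z: "I a \<beta> p q" "Z = affine_field \<theta> A a \<beta> p q"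
        and Z': "I a' \<beta>' p' q'" "Z' = affine_field \<theta> A a' \<beta>' p' q'"
      by (elim exE conjE)
    have "(\<lambda>x. Z x + Z' x) = affine_field \<theta> A (a + a') (\<beta> + \<beta>') (p + p') (q + q')"
      by (simp add: Z(2) Z'(2) affine_field_def fun_eq_iff Lambda_add matrix_vector_right_distrib
          scaleR_add_left)
    from S[OF assms(5)[OF Z(1) Z'(1)] this] show ?case .
  next
    case (scale Z c)
    then obtain a \<beta> p q where Z: "I a \<beta> p q" "Z = affine_field \<theta> A a \<beta> p q"
      by (elim exE conjE)
    have "(\<lambda>x. c *\<^sub>R Z x) = affine_field \<theta> A (c * a) (c * \<beta>) (c *\<^sub>R p) (c *\<^sub>R q)"
      by (simp add: Z(2) affine_field_def fun_eq_iff Lambda_scale matrix_vector_mult_scaleR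
          scaleR_add_right)
    from S[OF assms(6)[OF Z(1), of c] this] show ?case .
  next
    case (bracket Z Z')
    then obtain a \<beta> p q a' \<beta>' p' q'
      where Z: "I a \<beta> p q" "Z = affine_field \<theta> A a \<beta> p q"
        and Z': "I a' \<beta>' p' q'" "Z' = affine_field \<theta> A a' \<beta>' p' q'"
      by (elim exE conjE)
    show ?case
      unfolding Z(2) Z'(2) lie_bracket_affine_field[OF comm]
      by (rule S[OF assms(7)[OF Z(1) Z'(1)] refl])
  qed
qed

lemma LARC_no_annihilator:
  assumes "LARC f0 f1" and "\<And>Z. Z \<in> generated_lie_algebra {f0, f1} \<Longrightarrow> c \<bullet> Z x = 0"
  shows "c = 0"
proof -
  have "span ((\<lambda>Z. Z x) ` generated_lie_algebra {f0, f1}) \<subseteq> {z. c \<bullet> z = 0}"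
    using assms(2) by (intro span_minimal subspace_hyperplane) auto
  then have "c \<in> {z. c \<bullet> z = 0}"
    using assms(1) unfolding LARC_def by blast
  then show ?thesis by simp
qed

lemma LARC_alpha_nonzero:
  assumes comm: "A ** \<theta> = \<theta> ** A" and larc: "LARC (linear_field \<theta> A \<xi>) (left_invariant_field \<theta> \<alpha> \<eta>)"
  shows "\<alpha> \<noteq> 0"
proof
  assume "\<alpha> = 0"
  have "(1, 0) \<bullet> Z (0, 0) = 0"
    if Z: "Z \<in> generated_lie_algebra {linear_field \<theta> A \<xi>, left_invariant_field \<theta> \<alpha> \<eta>}" for Z
  proof -
    have "\<exists>a \<beta> p q. a = 0 \<and> Z = affine_field \<theta> A a \<beta> p q"
      by (rule generated_lie_algebra_affine[where I = "\<lambda>a \<beta> p q. a = 0", OF comm _ _ _ _ _ _ Z])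
        (simp_all add: \<open>\<alpha> = 0\<close>)
    then show ?thesis
      by (auto simp: affine_field_def)
  qed
  then have "((1, 0) :: real \<times> (real^2)) = 0"
    by (rule LARC_no_annihilator[OF larc])
  then show False by (simp add: zero_prod_def)
qed

text \<open>If \<open>n \<bullet> (\<alpha>\<xi> + A\<eta>) = 0\<close>, put \<open>h = (n \<bullet> \<eta>) / \<alpha>\<close>. The conditions \<open>n \<bullet> p = -\<beta>lh\<close> and
\<open>n \<bullet> q = ah\<close> on the parameters of an \<open>affine_field\<close> then hold for both fields of the system and
survive brackets, because \<open>n\<close> is an eigencovector. At the identity they say that the covector
\<open>(-h, n)\<close> annihilates every field of the Lie algebra.\<close>

lemma LARC_eigencovector:
  assumes comm: "A ** \<theta> = \<theta> ** A" and larc: "LARC (linear_field \<theta> A \<xi>) (left_invariant_field \<theta> \<alpha> \<eta>)"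
    and A: "\<And>v. n \<bullet> (A *v v) = l * (n \<bullet> v)" and \<theta>: "\<And>v. n \<bullet> (\<theta> *v v) = \<sigma> * (n \<bullet> v)"
    and "n \<noteq> 0"
  shows "\<alpha> * (n \<bullet> \<xi>) + l * (n \<bullet> \<eta>) \<noteq> 0"
proof
  assume 0: "\<alpha> * (n \<bullet> \<xi>) + l * (n \<bullet> \<eta>) = 0"
  have \<alpha>: "\<alpha> \<noteq> 0" by (rule LARC_alpha_nonzero[OF comm larc])
  define h where "h = (n \<bullet> \<eta>) / \<alpha>"
  have h: "n \<bullet> \<eta> = \<alpha> * h" "n \<bullet> \<xi> = - l * h"
    using 0 \<alpha> by (simp_all add: h_def field_simps)
  define I where "I = (\<lambda>a \<beta> p q. n \<bullet> p = - \<beta> * l * h \<and> n \<bullet> q = a * h)"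
  have "(- h, n) \<bullet> Z (0, 0) = 0"
    if Z: "Z \<in> generated_lie_algebra {linear_field \<theta> A \<xi>, left_invariant_field \<theta> \<alpha> \<eta>}" for Z
  proof -
    have "\<exists>a \<beta> p q. I a \<beta> p q \<and> Z = affine_field \<theta> A a \<beta> p q"
    proof (rule generated_lie_algebra_affine[where I = I, OF comm _ _ _ _ _ _ Z])
      show "I 0 1 \<xi> 0" "I \<alpha> 0 0 \<eta>" "I 0 0 0 0"
        by (simp_all add: I_def h)
      show "I (a + a') (\<beta> + \<beta>') (p + p') (q + q')" if "I a \<beta> p q" "I a' \<beta>' p' q'"
        for a \<beta> p q a' \<beta>' p' q'
        using that by (simp add: I_def inner_add_right distrib_right)
      show "I (c * a) (c * \<beta>) (c *\<^sub>R p) (c *\<^sub>R q)" if "I a \<beta> p q" for a \<beta> p q c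
        using that by (simp add: I_def)
      show "I 0 0 (A *v (\<beta>' *\<^sub>R p - \<beta> *\<^sub>R p'))
          (A *v (\<beta>' *\<^sub>R q - \<beta> *\<^sub>R q') + (a *\<^sub>R p' - a' *\<^sub>R p) + \<theta> *v (a *\<^sub>R q' - a' *\<^sub>R q))"
        if "I a \<beta> p q" "I a' \<beta>' p' q'" for a \<beta> p q a' \<beta>' p' q'
        using that by (simp add: I_def A \<theta> inner_add_right inner_diff_right) (simp add: algebra_simps)
    qed
    then show ?thesis
      by (auto simp: I_def affine_field_def Lambda_0 rho_0)
  qed
  then have "(- h, n) = 0"
    by (rule LARC_no_annihilator[OF larc])
  with \<open>n \<noteq> 0\<close> show False by (simp add: zero_prod_def)
qed

section \<open>The adapted frame and the induced system\<close>

text \<open>Two waiting phases with drifts of opposite sign realise every displacement.\<close>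

lemma positive_combination:
  fixes a b d :: real
  assumes "a * b < 0"
  obtains S T where "0 < S" "0 < T" "S * a + T * b = d"
proof -
  have "\<exists>S T. 0 < S \<and> 0 < T \<and> S * a + T * b = d" if "0 < a" "b < 0" for a b :: real
    using that
    by (intro exI[of _ "(\<bar>d\<bar> + 1 + d) / a"] exI[of _ "- (\<bar>d\<bar> + 1) / b"])
       (auto simp: divide_simps)
  then show ?thesis
    using assms that by (metis add.commute mult_less_0_iff)
qed

lemma rot90_inner: "rot90 u \<bullet> v = - (u \<bullet> rot90 v)" "rot90 u \<bullet> u = 0"
  by (simp_all add: rot90_def inner_vec_def sum_2 algebra_simps)

lemma ex_antiderivative:
  fixes f :: "real \<Rightarrow> real"
  assumes "continuous_on UNIV f"
  obtains F where "F 0 = 0" "\<And>t. (F has_real_derivative f t) (at t)"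
  using has_vector_derivative_integral_0[OF assms]
  by (intro that[of "\<lambda>t. LBINT s=ereal 0..ereal t. f s"])
     (auto simp: has_real_derivative_iff_has_vector_derivative)

lemma vimage_quot_proj_eq_times_kernel:
  assumes "norm w = 1"
  shows "quot_proj w -` C = times_kernel w C"
proof (intro set_eqI iffI)
  fix x assume "x \<in> quot_proj w -` C"
  then have "(fst x, snd x \<bullet> rot90 w) \<in> C"
    by (cases x) simp
  moreover have "x = fst x *\<^sub>R (1, 0) + (snd x \<bullet> rot90 w) *\<^sub>R (0, rot90 w) + (snd x \<bullet> w) *\<^sub>R (0, w)"
    using rot90_decomp(1)[OF assms, of "snd x"] by (simp add: prod_eq_iff)
  ultimately show "x \<in> times_kernel w C"
    unfolding times_kernel_def by blast
next
  fix x assume "x \<in> times_kernel w C"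
  then obtain t s1 s2 where "x = (t, s1 *\<^sub>R rot90 w + s2 *\<^sub>R w)" "(t, s1) \<in> C"
    unfolding times_kernel_def by auto
  then show "x \<in> quot_proj w -` C"
    by (simp add: inner_add_left rot90_decomp(2,3)[OF assms])
qed

text \<open>For a \<open>2 \<times> 2\<close> matrix that annihilates a unit vector, rank one means being nonzero.\<close>

locale nilrank_one =
  fixes \<theta> A :: "real^2^2" and \<xi> \<eta> w :: "real^2" and \<alpha> u_lo u_hi :: real
  assumes comm: "A ** \<theta> = \<theta> ** A"
    and A_nonzero: "A \<noteq> 0"
    and range0: "u_lo < 0" "0 < u_hi"
    and larc: "LARC (linear_field \<theta> A \<xi>) (left_invariant_field \<theta> \<alpha> \<eta>)"
    and Aw: "A *v w = 0" and unit_w: "norm w = 1"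
begin

abbreviation n where "n \<equiv> rot90 w"
abbreviation X where "X \<equiv> linear_field \<theta> A \<xi>"
abbreviation Y where "Y \<equiv> left_invariant_field \<theta> \<alpha> \<eta>"
abbreviation \<Omega> where "\<Omega> \<equiv> {u_lo..u_hi}"

definition lam where "lam = n \<bullet> (A *v n)"
definition sig where "sig = n \<bullet> (\<theta> *v n)"

abbreviation E where "E \<equiv> exp_primitive sig"

definition FX :: "real \<times> real \<Rightarrow> real \<times> real" where
  "FX p = (0, lam * snd p + E (fst p) * (n \<bullet> \<xi>))"

definition FY :: "real \<times> real \<Rightarrow> real \<times> real" where
  "FY p = (\<alpha>, exp (sig * fst p) * (n \<bullet> \<eta>))"

lemma frame: "n \<bullet> n = 1" "w \<bullet> n = 0" "n \<bullet> w = 0" "w \<bullet> w = 1"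
  using rot90_decomp(2,3)[OF unit_w] unit_w by (auto simp: norm_eq_1 inner_commute)

lemma decomp: "v = (v \<bullet> n) *\<^sub>R n + (v \<bullet> w) *\<^sub>R w"
  by (rule rot90_decomp(1)[OF unit_w])

lemma A_apply: "A *v v = (v \<bullet> n) *\<^sub>R (A *v n)"
  by (subst decomp[of v]) (simp add: matrix_vector_right_distrib matrix_vector_mult_scaleR Aw)

lemma An_nonzero: "A *v n \<noteq> 0"
proof
  assume "A *v n = 0"
  then have "A *v v = 0" for v
    by (subst A_apply) simp
  then show False
    using A_nonzero by (metis matrix_eq matrix_vector_mult_0)
qed

lemma An: "A *v n = lam *\<^sub>R n + ((A *v n) \<bullet> w) *\<^sub>R w"
  using decomp[of "A *v n"] by (simp add: lam_def inner_commute)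

lemma eigen_A: "n \<bullet> (A *v v) = lam * (n \<bullet> v)"
  by (subst A_apply) (simp add: lam_def inner_commute)

lemma theta_w: "\<theta> *v w = (w \<bullet> (\<theta> *v w)) *\<^sub>R w"
proof -
  have "A *v (\<theta> *v w) = \<theta> *v (A *v w)"
    by (simp add: matrix_vector_mul_assoc comm)
  then have "((\<theta> *v w) \<bullet> n) *\<^sub>R (A *v n) = 0"
    using A_apply[of "\<theta> *v w"] by (simp add: Aw)
  then have "(\<theta> *v w) \<bullet> n = 0"
    using An_nonzero by simp
  then show ?thesis
    using decomp[of "\<theta> *v w"] by (simp add: inner_commute)
qed

lemma eigen_theta: "n \<bullet> (\<theta> *v v) = sig * (n \<bullet> v)"
proof -
  have "n \<bullet> (\<theta> *v v) = n \<bullet> ((v \<bullet> n) *\<^sub>R (\<theta> *v n) + (v \<bullet> w) *\<^sub>R (\<theta> *v w))"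
    by (subst decomp[of v]) (simp only: matrix_vector_right_distrib matrix_vector_mult_scaleR)
  also have "\<dots> = sig * (n \<bullet> v)"
    by (subst theta_w) (simp add: inner_add_right frame sig_def inner_commute)
  finally show ?thesis .
qed

lemma trace_eq: "trace A = lam"
proof -
  have e: "w $ 1 * w $ 1 + w $ 2 * w $ 2 = 1"
    using frame(4) by (simp add: inner_vec_def sum_2)
  have "A $ 1 $ 1 * w $ 1 + A $ 1 $ 2 * w $ 2 = 0" "A $ 2 $ 1 * w $ 1 + A $ 2 $ 2 * w $ 2 = 0"
    using Aw by (simp_all add: vec_eq_iff forall_2 matrix_vector_mult_def sum_2)
  with e have "A $ 1 $ 1 + A $ 2 $ 2 =
      - (w $ 2) * (A $ 1 $ 2 * w $ 1 - A $ 1 $ 1 * w $ 2)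
      + w $ 1 * (A $ 2 $ 2 * w $ 1 - A $ 2 $ 1 * w $ 2)"
    by algebra
  also have "\<dots> = lam"
    by (simp add: lam_def inner_vec_def sum_2 matrix_vector_mult_def rot90_def algebra_simps)
  finally show ?thesis
    by (simp add: trace_def sum_2)
qed

lemma alpha_nonzero: "\<alpha> \<noteq> 0"
  by (rule LARC_alpha_nonzero[OF comm larc])

text \<open>Up to the factor \<open>\<alpha>\<close> this is the pairing of \<open>n\<close> with \<open>\<alpha>\<xi> + A\<eta>\<close>.\<close>

definition b where "b = n \<bullet> \<xi> + lam * (n \<bullet> \<eta>) / \<alpha>"

lemma b_nonzero: "b \<noteq> 0"
proof -
  have "n \<noteq> 0" using frame(1) by auto
  then have "\<alpha> * (n \<bullet> \<xi>) + lam * (n \<bullet> \<eta>) \<noteq> 0"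
    by (rule LARC_eigencovector[OF comm larc eigen_A eigen_theta])
  then show ?thesis
    using alpha_nonzero by (simp add: b_def field_simps)
qed

lemma quot_proj_eq: "quot_proj w = (\<lambda>x. (fst x, snd x \<bullet> n))"
  by (auto simp: fun_eq_iff)

lemma bounded_linear_quot_proj: "bounded_linear (quot_proj w)"
  unfolding quot_proj_eq by (intro bounded_linear_intros)

lemma FX_related: "FX (quot_proj w x) = quot_proj w (X x)"
proof (cases x)
  case (Pair t v)
  have "(A *v v + Lambda \<theta> t \<xi>) \<bullet> n = n \<bullet> (A *v v) + n \<bullet> Lambda \<theta> t \<xi>"
    by (simp add: inner_add_left inner_commute[of n])
  then show ?thesis
    by (simp add: Pair FX_def eigen_A inner_Lambda_eigen[OF eigen_theta] inner_commute[of v])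
qed

lemma FY_related: "FY (quot_proj w x) = quot_proj w (Y x)"
proof (cases x)
  case (Pair t v)
  have "(rho \<theta> t *v \<eta>) \<bullet> n = exp (sig * t) * (n \<bullet> \<eta>)"
    using inner_rho_eigen[OF eigen_theta, of t \<eta>] by (simp only: inner_commute)
  then show ?thesis
    by (simp add: Pair FY_def)
qed

lemma proj_field_X: "proj_field (quot_proj w) X = FX"
  by (rule proj_field_eqI(1)[OF surj_quot_proj[OF unit_w]])
    (simp add: related_field_def frechet_derivative_quot_proj FX_related)

lemma proj_field_Y: "proj_field (quot_proj w) Y = FY"
  by (rule proj_field_eqI(1)[OF surj_quot_proj[OF unit_w]])
    (simp add: related_field_def frechet_derivative_quot_proj FY_related)

lemma X_translate: "X (x + (0, c *\<^sub>R w)) = X x" and Y_translate: "Y (x + (0, c *\<^sub>R w)) = Y x"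
  by (cases x; simp add: matrix_vector_right_distrib matrix_vector_mult_scaleR Aw)+

section \<open>Lifting reachability from the quotient\<close>

text \<open>The fields do not depend on the fibre coordinate \<open>v \<bullet> w\<close>, so its velocity along the lift is a
known continuous function of time and the lift is found by one integration.\<close>

lemma lift_curve:
  assumes \<psi>: "\<And>s. (\<psi> has_vector_derivative FX (\<psi> s) + u *\<^sub>R FY (\<psi> s)) (at s)"
    and x: "quot_proj w x = \<psi> 0"
  obtains \<phi> where "\<phi> 0 = x" "\<And>s. quot_proj w (\<phi> s) = \<psi> s"
    "\<And>s. (\<phi> has_vector_derivative X (\<phi> s) + u *\<^sub>R Y (\<phi> s)) (at s)"
proof -
  let ?base = "\<lambda>s. (fst (\<psi> s), snd (\<psi> s) *\<^sub>R n)"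
  define f where "f = (\<lambda>s. snd (X (?base s) + u *\<^sub>R Y (?base s)))"
  have c\<psi>: "continuous_on UNIV \<psi>"
    by (intro continuous_at_imp_continuous_on ballI has_vector_derivative_continuous[OF \<psi>])
  have cL: "continuous_on UNIV (\<lambda>t. Lambda \<theta> t \<xi>)"
    by (intro continuous_at_imp_continuous_on ballI
        has_vector_derivative_continuous[OF has_vector_derivative_Lambda])
  have "continuous_on UNIV f"
    unfolding f_def linear_field.simps left_invariant_field.simps snd_add snd_scaleR snd_conv
    by (intro continuous_intros continuous_on_compose2[OF cL] c\<psi>
        continuous_on_compose2[OF continuous_rho[of UNIV]]
        bounded_linear.continuous_on[OF matrix_vector_mul_bounded_linear]) auto
  then have "continuous_on UNIV (\<lambda>s. f s \<bullet> w)"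
    by (intro continuous_intros)
  then obtain G where G: "G 0 = 0" "\<And>s. (G has_real_derivative f s \<bullet> w) (at s)"
    by (rule ex_antiderivative) (rule that)
  define \<phi> where "\<phi> = (\<lambda>s. (fst (\<psi> s), snd (\<psi> s) *\<^sub>R n + (snd x \<bullet> w + G s) *\<^sub>R w))"
  have proj: "quot_proj w (\<phi> s) = \<psi> s" for s
    by (simp add: \<phi>_def inner_add_left frame)
  have base: "quot_proj w (?base s) = \<psi> s" for s
    by (simp add: frame)
  have Xb: "X (\<phi> s) = X (?base s)" "Y (\<phi> s) = Y (?base s)" for s
    using X_translate[of "?base s" "snd x \<bullet> w + G s"] Y_translate[of "?base s" "snd x \<bullet> w + G s"]
    by (simp_all add: \<phi>_def)
  show thesis
  proof
    show "\<phi> 0 = x"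
      by (simp add: \<phi>_def G(1) flip: x) (simp add: quot_proj_eq decomp[of "snd x", symmetric])
    show "quot_proj w (\<phi> s) = \<psi> s" for s by (rule proj)
    fix s
    have "FX (\<psi> s) + u *\<^sub>R FY (\<psi> s) = quot_proj w (X (?base s) + u *\<^sub>R Y (?base s))"
      using FX_related[of "?base s"] FY_related[of "?base s"]
        bounded_linear.linear[OF bounded_linear_quot_proj]
      by (simp only: base linear_add linear_scale)
    then have F: "fst (FX (\<psi> s) + u *\<^sub>R FY (\<psi> s)) = fst (X (?base s) + u *\<^sub>R Y (?base s))"
        "snd (FX (\<psi> s) + u *\<^sub>R FY (\<psi> s)) = f s \<bullet> n"
      by (simp_all add: quot_proj_eq f_def)
    have 1: "((\<lambda>s. fst (\<psi> s)) has_vector_derivative fst (FX (\<psi> s) + u *\<^sub>R FY (\<psi> s))) (at s)"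
      by (rule bounded_linear.has_vector_derivative[OF bounded_linear_fst \<psi>])
    have 2: "((\<lambda>s. snd (\<psi> s) *\<^sub>R n) has_vector_derivative (f s \<bullet> n) *\<^sub>R n) (at s)"
      using bounded_linear.has_vector_derivative[OF bounded_linear_scaleR_left
          bounded_linear.has_vector_derivative[OF bounded_linear_snd \<psi>], of n s]
      by (simp only: F)
    have 3: "((\<lambda>s. (snd x \<bullet> w + G s) *\<^sub>R w) has_vector_derivative (f s \<bullet> w) *\<^sub>R w) (at s)"
      using G(2)[of s]
      by (intro bounded_linear.has_vector_derivative[OF bounded_linear_scaleR_left])
         (auto simp: has_real_derivative_iff_has_vector_derivative[symmetric]
           intro!: derivative_eq_intros)
    have "(\<phi> has_vector_derivative
        (fst (FX (\<psi> s) + u *\<^sub>R FY (\<psi> s)), (f s \<bullet> n) *\<^sub>R n + (f s \<bullet> w) *\<^sub>R w)) (at s)"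
      unfolding \<phi>_def by (intro has_vector_derivative_Pair has_vector_derivative_add 1 2 3)
    also have "(fst (FX (\<psi> s) + u *\<^sub>R FY (\<psi> s)), (f s \<bullet> n) *\<^sub>R n + (f s \<bullet> w) *\<^sub>R w) =
        X (\<phi> s) + u *\<^sub>R Y (\<phi> s)"
      unfolding F(1) decomp[of "f s", symmetric] Xb by (simp add: f_def prod_eq_iff)
    finally show "(\<phi> has_vector_derivative X (\<phi> s) + u *\<^sub>R Y (\<phi> s)) (at s)" .
  qed
qed

text \<open>The position along the fibre is left open: it is corrected afterwards, by waiting.\<close>

definition lifts :: "real \<times> real \<Rightarrow> real \<times> real \<Rightarrow> bool" where
  "lifts p p' \<longleftrightarrow>
     (\<forall>x. quot_proj w x = p \<longrightarrow> (\<exists>x'. quot_proj w x' = p' \<and> reachable X Y \<Omega> x x'))"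

lemma lifts_trans [trans]: "lifts p q \<Longrightarrow> lifts q r \<Longrightarrow> lifts p r"
  unfolding lifts_def using reachable_trans by blast

lemma lifts_curve:
  assumes "\<And>s. (\<psi> has_vector_derivative FX (\<psi> s) + u *\<^sub>R FY (\<psi> s)) (at s)"
    and "u \<in> \<Omega>" "0 \<le> T"
  shows "lifts (\<psi> 0) (\<psi> T)"
  unfolding lifts_def
proof (intro allI impI)
  fix x assume "quot_proj w x = \<psi> 0"
  with assms(1) obtain \<phi> where "\<phi> 0 = x" "\<And>s. quot_proj w (\<phi> s) = \<psi> s"
    "\<And>s. (\<phi> has_vector_derivative X (\<phi> s) + u *\<^sub>R Y (\<phi> s)) (at s)"
    by (rule lift_curve) (rule that)
  then show "\<exists>x'. quot_proj w x' = \<psi> T \<and> reachable X Y \<Omega> x x'"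
    using constant_control_reachable[of \<phi> X u Y \<Omega> T] assms(2,3)
    by (intro exI[of _ "\<phi> T"]) simp
qed

lemma wait_over_equilibrium:
  assumes "\<And>x. quot_proj w x = p \<Longrightarrow> X x = (0, r *\<^sub>R w)" "quot_proj w x = p" "0 < T"
  shows "x + (0, (T * r) *\<^sub>R w) \<in> positive_orbit X Y \<Omega> x"
proof -
  let ?\<phi> = "\<lambda>s. x + s *\<^sub>R (0, r *\<^sub>R w)"
  have d: "(?\<phi> has_vector_derivative (0, r *\<^sub>R w)) (at s)" for s
    by (auto intro!: derivative_eq_intros)
  have "X (?\<phi> s) = (0, r *\<^sub>R w)" for s
    using X_translate[of x "s * r"] assms(1)[OF assms(2)] by simp
  then have "(?\<phi> has_vector_derivative X (?\<phi> s) + 0 *\<^sub>R Y (?\<phi> s)) (at s)" for s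
    using d by simp
  from constant_control_orbit[OF this, of \<Omega> T] show ?thesis
    using range0 assms(3) by (simp flip: zero_prod_def)
qed

text \<open>Travel over the base to \<open>p\<close>, wait, travel to \<open>q\<close>, wait, travel to the final base point. Translations
along the fibre are symmetries, so the total displacement along the fibre is a constant plus the
contributions of the two waits. These have opposite signs, hence can be chosen to give
any value.\<close>

lemma transitive_over:
  assumes base: "\<And>p p'. p \<in> S \<Longrightarrow> p' \<in> S \<Longrightarrow> lifts p p'"
    and p: "p \<in> S" "\<And>x. quot_proj w x = p \<Longrightarrow> X x = (0, r *\<^sub>R w)"
    and q: "q \<in> S" "\<And>x. quot_proj w x = q \<Longrightarrow> X x = (0, r' *\<^sub>R w)"
    and opp: "r * r' < 0"
    and x: "quot_proj w x \<in> S" "quot_proj w x' \<in> S"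
  shows "x' \<in> positive_orbit X Y \<Omega> x"
proof -
  let ?tr = "\<lambda>c. (0 :: real, c *\<^sub>R w)"
  obtain x1 where x1: "quot_proj w x1 = p" "reachable X Y \<Omega> x x1"
    using base[OF x(1) p(1)] unfolding lifts_def by blast
  obtain x2 where x2: "quot_proj w x2 = q" "reachable X Y \<Omega> x1 x2"
    using base[OF p(1) q(1)] x1(1) unfolding lifts_def by blast
  obtain x3 where x3: "quot_proj w x3 = quot_proj w x'" "reachable X Y \<Omega> x2 x3"
    using base[OF q(1) x(2)] x2(1) unfolding lifts_def by blast
  have e: "(snd x' - snd x3) \<bullet> n = 0" "fst x' = fst x3"
    using x3(1) by (auto simp: quot_proj_eq inner_diff_left)
  have "snd x' - snd x3 = ((snd x' - snd x3) \<bullet> w) *\<^sub>R w"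
    by (rule trans[OF decomp]) (simp add: e(1))
  then have "snd x' = snd x3 + ((snd x' - snd x3) \<bullet> w) *\<^sub>R w"
    by (metis add.commute diff_add_cancel)
  then have "x' = x3 + ?tr ((snd x' - snd x3) \<bullet> w)"
    using e(2) by (intro prod_eqI) (simp_all only: fst_add snd_add fst_conv snd_conv add_0_right)
  moreover obtain T T' where T: "0 < T" "0 < T'" "T * r + T' * r' = (snd x' - snd x3) \<bullet> w"
    using positive_combination[OF opp] by metis
  ultimately have x': "x' = x3 + ?tr (T * r + T' * r')"
    by simp
  note shift = reachable_translate[of X "?tr c" Y for c, OF X_translate Y_translate]
  have "x1 + ?tr (T * r) \<in> positive_orbit X Y \<Omega> x1"
    by (rule wait_over_equilibrium[OF p(2) x1(1) T(1)])
  then have "x1 + ?tr (T * r) \<in> positive_orbit X Y \<Omega> x"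
    by (rule reachable_positive_orbit(1)[OF x1(2)])
  then have "x2 + ?tr (T * r) \<in> positive_orbit X Y \<Omega> x"
    by (rule reachable_positive_orbit(2)[OF _ shift[OF x2(2)]])
  moreover have "quot_proj w (x2 + ?tr (T * r)) = q"
    using x2(1) by (simp add: quot_proj_eq inner_add_left frame)
  then have "x2 + ?tr (T * r) + ?tr (T' * r') \<in> positive_orbit X Y \<Omega> (x2 + ?tr (T * r))"
    by (intro wait_over_equilibrium[OF q(2) _ T(2)])
  ultimately have "x2 + ?tr (T * r) + ?tr (T' * r') \<in> positive_orbit X Y \<Omega> x"
    by (rule positive_orbit_trans)
  moreover have "x2 + ?tr (T * r) + ?tr (T' * r') = x2 + ?tr (T * r + T' * r')"
    by (simp add: scaleR_add_left add.assoc)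
  ultimately have "x2 + ?tr (T * r + T' * r') \<in> positive_orbit X Y \<Omega> x"
    by simp
  then show ?thesis
    unfolding x' by (rule reachable_positive_orbit(2)[OF _ shift[OF x3(2)]])
qed

section \<open>The coordinate that decouples the quotient when the trace is nonzero\<close>

text \<open>The rate \<open>v = \<alpha>u\<close> at which \<open>t\<close> changes ranges over \<open>[lo, hi]\<close>.\<close>

definition lo where "lo = (if \<alpha> > 0 then \<alpha> * u_lo else \<alpha> * u_hi)"
definition hi where "hi = (if \<alpha> > 0 then \<alpha> * u_hi else \<alpha> * u_lo)"

lemma lo_hi: "lo < 0" "0 < hi"
  using range0 alpha_nonzero by (auto simp: lo_def hi_def mult_less_0_iff zero_less_mult_iff)

lemma control_of_rate: "lo \<le> v \<Longrightarrow> v \<le> hi \<Longrightarrow> v / \<alpha> \<in> \<Omega>"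
  using alpha_nonzero by (auto simp: lo_def hi_def field_simps split: if_splits)

lemma rate_of_control: "u \<in> \<Omega> \<Longrightarrow> lo \<le> \<alpha> * u" "u \<in> \<Omega> \<Longrightarrow> \<alpha> * u \<le> hi"
  by (auto simp: lo_def hi_def mult_left_mono mult_left_mono_neg)

text \<open>The point of the quotient with coordinates \<open>t\<close> and \<open>y\<close>. Subtracting \<open>(n \<bullet> \<eta>) / \<alpha> * E t\<close> from
\<open>s\<close> removes the control from the equation for \<open>s\<close>, which becomes \<open>s' = lam s + b E t\<close> with the
equilibrium \<open>-b / lam * E t\<close>; the coordinate \<open>y\<close> is the distance to it in the unit
\<open>-b / lam * exp (\<sigma>t)\<close>.\<close>

definition ypoint :: "real \<Rightarrow> real \<Rightarrow> real \<times> real" where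
  "ypoint t y = (t, (n \<bullet> \<eta>) / \<alpha> * E t - b / lam * (exp (sig * t) * y + E t))"

definition ycoord :: "real \<times> real \<Rightarrow> real" where
  "ycoord p = - exp (- (sig * fst p)) * (lam * (snd p - (n \<bullet> \<eta>) / \<alpha> * E (fst p)) / b + E (fst p))"

lemma fst_ypoint [simp]: "fst (ypoint t y) = t"
  by (simp add: ypoint_def)

lemma exp_cancel: "exp (- x) * (exp x * y) = (y :: real)" "exp x * (exp (- x) * y) = y"
  by (simp_all add: exp_minus)

lemma ycoord_ypoint:
  assumes "lam \<noteq> 0"
  shows "ycoord (ypoint t y) = y"
proof -
  have "lam * (snd (ypoint t y) - (n \<bullet> \<eta>) / \<alpha> * E t) / b = - (exp (sig * t) * y + E t)"
    using assms b_nonzero by (simp add: ypoint_def)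
  then show ?thesis
    unfolding ycoord_def fst_ypoint by (simp add: exp_cancel)
qed

lemma ypoint_ycoord:
  assumes "lam \<noteq> 0"
  shows "ypoint (fst p) (ycoord p) = p"
proof -
  have "exp (sig * fst p) * ycoord p = - (lam * (snd p - (n \<bullet> \<eta>) / \<alpha> * E (fst p)) / b + E (fst p))"
    unfolding ycoord_def by (simp add: exp_cancel)
  then show ?thesis
    using assms b_nonzero by (simp add: ypoint_def prod_eq_iff)
qed

lemma continuous_on_ycoord: "continuous_on S ycoord"
  unfolding ycoord_def using b_nonzero by (intro continuous_intros) auto

lemma continuous_on_ypoint: "continuous_on S f \<Longrightarrow> continuous_on S (\<lambda>s. ypoint t (f s))"
  unfolding ypoint_def by (intro continuous_intros)

lemma ypoint_curve:
  assumes "lam \<noteq> 0" and t: "(t has_real_derivative v) (at s)"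
    and y: "(y has_real_derivative lam * y s - v * (sig * y s + 1)) (at s)"
  shows "((\<lambda>s. ypoint (t s) (y s)) has_vector_derivative
    FX (ypoint (t s) (y s)) + (v / \<alpha>) *\<^sub>R FY (ypoint (t s) (y s))) (at s)"
proof -
  let ?D = "(n \<bullet> \<eta>) / \<alpha> * (exp (sig * t s) * v) - b / lam * (exp (sig * t s) * (lam * y s))"
  have "((\<lambda>s. (n \<bullet> \<eta>) / \<alpha> * E (t s) - b / lam * (exp (sig * t s) * y s + E (t s)))
      has_real_derivative ?D) (at s)"
    by (rule DERIV_cong, (rule derivative_intros t y)+) (simp add: algebra_simps)
  then have "((\<lambda>s. ypoint (t s) (y s)) has_vector_derivative (v, ?D)) (at s)"
    unfolding ypoint_def using t
    by (intro has_vector_derivative_Pair)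
       (simp_all add: has_real_derivative_iff_has_vector_derivative)
  moreover have "FX (ypoint (t s) (y s)) + (v / \<alpha>) *\<^sub>R FY (ypoint (t s) (y s)) = (v, ?D)"
    using assms(1) alpha_nonzero
    by (simp add: FX_def FY_def ypoint_def b_def right_diff_distrib) (simp add: algebra_simps add_divide_distrib)
  ultimately show ?thesis
    by simp
qed

lemma ycoord_along_curve:
  assumes "lam \<noteq> 0" and \<psi>: "(\<psi> has_vector_derivative FX (\<psi> s) + u *\<^sub>R FY (\<psi> s)) (at s)"
  shows "((\<lambda>s. fst (\<psi> s)) has_real_derivative \<alpha> * u) (at s)"
    and "((\<lambda>s. ycoord (\<psi> s)) has_real_derivative
      lam * ycoord (\<psi> s) - \<alpha> * u * (sig * ycoord (\<psi> s) + 1)) (at s)"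
proof -
  let ?t = "fst (\<psi> s)" and ?z = "snd (\<psi> s)"
  let ?dz = "lam * ?z + E ?t * (n \<bullet> \<xi>) + u * (exp (sig * ?t) * (n \<bullet> \<eta>))"
  show t: "((\<lambda>s. fst (\<psi> s)) has_real_derivative \<alpha> * u) (at s)"
    using bounded_linear.has_vector_derivative[OF bounded_linear_fst \<psi>]
    by (simp add: FX_def FY_def has_real_derivative_iff_has_vector_derivative mult.commute)
  have z: "((\<lambda>s. snd (\<psi> s)) has_real_derivative ?dz) (at s)"
    using bounded_linear.has_vector_derivative[OF bounded_linear_snd \<psi>]
    by (simp add: FX_def FY_def has_real_derivative_iff_has_vector_derivative)
  define Q where "Q = lam * (?z - (n \<bullet> \<eta>) / \<alpha> * E ?t) / b + E ?t"
  have ycoord: "ycoord (\<psi> s) = - exp (- (sig * ?t)) * Q"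
    by (simp add: ycoord_def Q_def)
  have "lam * ?z + E ?t * (n \<bullet> \<xi>) = b * Q"
  proof -
    have "b * Q = lam * (?z - (n \<bullet> \<eta>) / \<alpha> * E ?t) + b * E ?t"
      using b_nonzero by (simp add: Q_def distrib_left)
    then show ?thesis
      by (simp add: b_def algebra_simps)
  qed
  then have q: "lam * (?dz - (n \<bullet> \<eta>) / \<alpha> * (exp (sig * ?t) * (\<alpha> * u))) / b = lam * Q"
    using b_nonzero alpha_nonzero by simp
  have cancel: "exp (?t * sig) * exp (- (?t * sig)) = 1"
    by (simp add: exp_minus)
  have "((\<lambda>s. ycoord (\<psi> s)) has_real_derivative
      sig * (\<alpha> * u) * exp (- (sig * ?t)) * Q - exp (- (sig * ?t)) *
        (lam * (?dz - (n \<bullet> \<eta>) / \<alpha> * (exp (sig * ?t) * (\<alpha> * u))) / b + exp (sig * ?t) * (\<alpha> * u))) (at s)"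
    unfolding ycoord_def Q_def
    by (rule DERIV_cong, (rule DERIV_cdivide derivative_intros t z)+)
      (simp add: algebra_simps add_divide_distrib diff_divide_distrib)
  then show "((\<lambda>s. ycoord (\<psi> s)) has_real_derivative
      lam * ycoord (\<psi> s) - \<alpha> * u * (sig * ycoord (\<psi> s) + 1)) (at s)"
    unfolding q by (rule DERIV_cong) (simp add: ycoord algebra_simps cancel)
qed

text \<open>The velocity \<open>lam y - v (\<sigma>y + 1)\<close> of \<open>y\<close> is positive for \<open>v = lo\<close> and negative for \<open>v = hi\<close>.\<close>

definition K_open :: "real set" where
  "K_open = {y. lo * (sig * y + 1) < lam * y \<and> lam * y < hi * (sig * y + 1)}"

definition K_closed :: "real set" where
  "K_closed = {y. lo * (sig * y + 1) \<le> lam * y \<and> lam * y \<le> hi * (sig * y + 1)}"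

section \<open>Barrier functions and maximality\<close>

text \<open>The numbers \<open>\<nu>\<close> and \<open>\<epsilon>\<close> are meant to be \<open>hi\<close> and \<open>1\<close>, or \<open>lo\<close> and \<open>-1\<close>. The factor \<open>exp (\<sigma>t)\<close> turns
the defining expression of \<open>K_open\<close>, whose zero set is invariant under the rate \<open>\<nu>\<close>, into an
eigenfunction of that rate.\<close>

definition barrier :: "real \<Rightarrow> real \<Rightarrow> real \<times> real \<Rightarrow> real" where
  "barrier \<epsilon> \<nu> p = \<epsilon> * exp (sig * fst p) * (\<nu> * (sig * ycoord p + 1) - lam * ycoord p)"

lemma continuous_on_barrier: "continuous_on S (barrier \<epsilon> \<nu>)"
  unfolding barrier_def by (intro continuous_intros continuous_on_ycoord)

text \<open>Along a trajectory with rate \<open>v\<close> the barrier \<open>W\<close> satisfies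
\<open>W' = lam W + lam exp (\<sigma>t) \<epsilon> (v - \<nu>)\<close>, and \<open>\<epsilon> (v - \<nu>) \<le> 0\<close>. So \<open>exp (-lam s) W\<close> is monotone, on
all of the quotient and not only near the zero set of \<open>W\<close>.\<close>

lemma barrier_growth:
  assumes "lam \<noteq> 0" and ext: "\<And>v. lo \<le> v \<Longrightarrow> v \<le> hi \<Longrightarrow> \<epsilon> * (v - \<nu>) \<le> 0"
    and u: "u \<in> controls \<Omega>" and sol: "solution FX FY u p \<psi>" and T: "0 \<le> T"
  shows "lam > 0 \<Longrightarrow> barrier \<epsilon> \<nu> (\<psi> T) \<le> exp (lam * T) * barrier \<epsilon> \<nu> p"
    and "lam < 0 \<Longrightarrow> exp (lam * T) * barrier \<epsilon> \<nu> p \<le> barrier \<epsilon> \<nu> (\<psi> T)"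
proof -
  from sol obtain P where P: "\<psi> 0 = p" "continuous_on UNIV \<psi>" "locally_finite_times P"
      "\<And>s. s \<notin> P \<Longrightarrow> (\<psi> has_vector_derivative (FX (\<psi> s) + u s *\<^sub>R FY (\<psi> s))) (at s)"
    unfolding solution_def by blast
  let ?W = "\<lambda>s. barrier \<epsilon> \<nu> (\<psi> s)"
  let ?g = "\<lambda>s. exp (- (lam * s)) * ?W s"
  let ?g' = "\<lambda>s. exp (- (lam * s)) * (lam * exp (sig * fst (\<psi> s)) * (\<epsilon> * (\<alpha> * u s - \<nu>)))"
  have W: "(?W has_real_derivative
      lam * ?W s + lam * exp (sig * fst (\<psi> s)) * (\<epsilon> * (\<alpha> * u s - \<nu>))) (at s)"
    if "s \<notin> P" for s
    unfolding barrier_def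
    by (rule DERIV_cong, (rule derivative_intros ycoord_along_curve[OF assms(1) P(4)[OF that]])+)
      (simp add: algebra_simps)
  have d: "(?g has_real_derivative ?g' s) (at s)" if "s \<notin> P" for s
    by (rule DERIV_cong, (rule derivative_intros W that)+) (simp add: algebra_simps)
  have cg: "continuous_on UNIV ?g"
    by (intro continuous_intros continuous_on_compose2[OF continuous_on_barrier[of UNIV]] P(2)) auto
  have sgn: "\<epsilon> * (\<alpha> * u s - \<nu>) \<le> 0" for s
  proof -
    have "u s \<in> \<Omega>"
      using u unfolding controls_def by blast
    then show ?thesis
      by (intro ext rate_of_control)
  qed
  have e: "exp (lam * T) * ?g T = ?W T"
    by (simp add: exp_cancel)
  show "barrier \<epsilon> \<nu> (\<psi> T) \<le> exp (lam * T) * barrier \<epsilon> \<nu> p" if "lam > 0"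
  proof -
    have "- ?g 0 \<le> - ?g T"
    proof (rule nondecreasing_off_locally_finite[where g = "\<lambda>s. - ?g s", OF _ P(3) _ _ T])
      show "((\<lambda>s. - ?g s) has_real_derivative - ?g' s) (at s)" if "s \<notin> P" for s
        by (intro DERIV_minus d that)
      show "0 \<le> - ?g' s" for s
        using sgn[of s] \<open>lam > 0\<close> by (simp add: mult_nonneg_nonpos zero_le_mult_iff mult_le_0_iff)
    qed (intro continuous_intros cg)
    then have "exp (lam * T) * ?g T \<le> exp (lam * T) * ?g 0"
      by (intro mult_left_mono) auto
    then show ?thesis
      unfolding e using P(1) by simp
  qed
  show "exp (lam * T) * barrier \<epsilon> \<nu> p \<le> barrier \<epsilon> \<nu> (\<psi> T)" if "lam < 0"
  proof -
    have "?g 0 \<le> ?g T"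
    proof (rule nondecreasing_off_locally_finite[where g = ?g, OF cg P(3) d _ T])
      show "0 \<le> ?g' s" for s
        using sgn[of s] \<open>lam < 0\<close> by (simp add: zero_le_mult_iff mult_le_0_iff)
    qed
    then have "exp (lam * T) * ?g 0 \<le> exp (lam * T) * ?g T"
      by (intro mult_left_mono) auto
    then show ?thesis
      unfolding e using P(1) by simp
  qed
qed

lemma closure_orbit_barrier:
  assumes "\<And>u \<psi> T. u \<in> controls \<Omega> \<Longrightarrow> solution FX FY u p \<psi> \<Longrightarrow> 0 < T \<Longrightarrow> barrier \<epsilon> \<nu> (\<psi> T) \<in> I"
    and "closed I" "q \<in> closure (positive_orbit FX FY \<Omega> p)"
  shows "barrier \<epsilon> \<nu> q \<in> I"
proof -
  have "positive_orbit FX FY \<Omega> p \<subseteq> barrier \<epsilon> \<nu> -` I"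
  proof
    fix q assume "q \<in> positive_orbit FX FY \<Omega> p"
    then obtain S u \<phi> where "S > 0" "u \<in> controls \<Omega>" "solution FX FY u p \<phi>" "q = \<phi> S"
      by (rule positive_orbitE)
    then show "q \<in> barrier \<epsilon> \<nu> -` I"
      using assms(1) by simp
  qed
  moreover have "closed (barrier \<epsilon> \<nu> -` I)"
    using assms(2) continuous_on_barrier[of UNIV] by (intro closed_vimage) auto
  ultimately show ?thesis
    using assms(3) closure_minimal by blast
qed

context
  fixes \<epsilon> \<nu> :: real
  assumes lam: "lam \<noteq> 0" and ext: "\<And>v. lo \<le> v \<Longrightarrow> v \<le> hi \<Longrightarrow> \<epsilon> * (v - \<nu>) \<le> 0"
begin

lemma closure_orbit_barrier_unstable:
  assumes "lam > 0" "barrier \<epsilon> \<nu> p \<le> 0" "q \<in> closure (positive_orbit FX FY \<Omega> p)"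
  shows "barrier \<epsilon> \<nu> q \<le> barrier \<epsilon> \<nu> p"
proof -
  have "barrier \<epsilon> \<nu> q \<in> {..barrier \<epsilon> \<nu> p}"
  proof (rule closure_orbit_barrier[OF _ _ assms(3)])
    fix u \<psi> and T :: real
    assume a: "u \<in> controls \<Omega>" "solution FX FY u p \<psi>" "0 < T"
    have "exp (lam * T) * barrier \<epsilon> \<nu> p \<le> 1 * barrier \<epsilon> \<nu> p"
      using assms(1,2) a(3) by (intro mult_right_mono_neg) auto
    then show "barrier \<epsilon> \<nu> (\<psi> T) \<in> {..barrier \<epsilon> \<nu> p}"
      using barrier_growth(1)[OF lam ext a(1,2), of T] assms(1) a(3) by simp
  qed simp
  then show ?thesis by simp
qed

lemma closure_orbit_barrier_stable:
  assumes "lam < 0" "q \<in> closure (positive_orbit FX FY \<Omega> p)"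
  shows "min (barrier \<epsilon> \<nu> p) 0 \<le> barrier \<epsilon> \<nu> q"
proof -
  have "barrier \<epsilon> \<nu> q \<in> {min (barrier \<epsilon> \<nu> p) 0..}"
  proof (rule closure_orbit_barrier[OF _ _ assms(2)])
    fix u \<psi> and T :: real
    assume a: "u \<in> controls \<Omega>" "solution FX FY u p \<psi>" "0 < T"
    have "exp (lam * T) \<le> 1"
      using assms(1) a(3) by (simp add: mult_nonpos_nonneg)
    then have "min (barrier \<epsilon> \<nu> p) 0 \<le> exp (lam * T) * barrier \<epsilon> \<nu> p"
      using mult_right_mono_neg[of "exp (lam * T)" 1 "barrier \<epsilon> \<nu> p"]
      by (cases "barrier \<epsilon> \<nu> p \<le> 0") (auto simp: min_def)
    then show "barrier \<epsilon> \<nu> (\<psi> T) \<in> {min (barrier \<epsilon> \<nu> p) 0..}"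
      using barrier_growth(2)[OF lam ext a(1,2), of T] assms(1) a(3) by simp
  qed simp
  then show ?thesis by simp
qed

text \<open>Where the barrier is nonpositive, moving \<open>y\<close> away from \<open>0\<close> decreases it strictly. An interior point
\<open>p\<close> thus has a companion \<open>q\<close> in \<open>D\<close> with a smaller value. One of the two cannot be approached
from the other: \<open>p\<close> from \<open>q\<close> if \<open>lam > 0\<close>, and \<open>q\<close> from \<open>p\<close> if \<open>lam < 0\<close>.\<close>

lemma no_interior_point_outside:
  assumes "0 < \<epsilon> * \<nu>" and at: "approx_transitive FX FY \<Omega> D" and p: "p \<in> interior D"
    and nonpos: "barrier \<epsilon> \<nu> p \<le> 0"
  shows False
proof -
  define f where "f = (\<lambda>d. ypoint (fst p) ((1 + d) * ycoord p))"
  have "continuous_on UNIV f"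
    unfolding f_def by (intro continuous_on_ypoint continuous_intros)
  then have "open (f -` interior D)"
    by (intro open_vimage) auto
  moreover have "0 \<in> f -` interior D"
    using p by (simp add: f_def ypoint_ycoord[OF lam])
  ultimately obtain e where "e > 0" "ball 0 e \<subseteq> f -` interior D"
    by (meson openE)
  then have "e / 2 \<in> ball 0 e" "e / 2 > 0"
    by auto
  with \<open>ball 0 e \<subseteq> f -` interior D\<close> have "f (e / 2) \<in> D" "e / 2 > 0"
    using interior_subset[of D] by blast+
  moreover have "barrier \<epsilon> \<nu> (f d) < barrier \<epsilon> \<nu> p" if "d > 0" for d
  proof -
    have "\<epsilon> * (\<nu> * (sig * ycoord p + 1) - lam * ycoord p) \<le> 0"
      using nonpos by (simp add: barrier_def mult.assoc mult_le_0_iff zero_le_mult_iff)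
    then have "\<epsilon> * (\<nu> * sig - lam) * ycoord p < 0"
      using assms(1) by (simp add: algebra_simps)
    moreover have "0 < exp (sig * fst p) * d"
      using that by simp
    ultimately have "exp (sig * fst p) * d * (\<epsilon> * (\<nu> * sig - lam) * ycoord p) < 0"
      by (rule mult_pos_neg[rotated])
    moreover have "barrier \<epsilon> \<nu> (f d) = barrier \<epsilon> \<nu> p + exp (sig * fst p) * d * (\<epsilon> * (\<nu> * sig - lam) * ycoord p)"
      by (simp add: barrier_def f_def ycoord_ypoint[OF lam] algebra_simps)
    ultimately show ?thesis by simp
  qed
  ultimately obtain q where q: "q \<in> D" "barrier \<epsilon> \<nu> q < barrier \<epsilon> \<nu> p"
    by blast
  have pD: "p \<in> D"
    using p interior_subset by blast
  have "q \<in> closure (positive_orbit FX FY \<Omega> p)" "p \<in> closure (positive_orbit FX FY \<Omega> q)"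
    using at q(1) pD by (auto simp: approx_transitive_def)
  then show False
    using closure_orbit_barrier_unstable[of q p] closure_orbit_barrier_stable[of q p] q(2) nonpos lam
    by (cases "lam > 0") auto
qed

end

lemma ycoord_in_K_iff_barrier:
  "ycoord p \<in> K_open \<longleftrightarrow> 0 < barrier 1 hi p \<and> 0 < barrier (- 1) lo p"
  "ycoord p \<in> K_closed \<longleftrightarrow> 0 \<le> barrier 1 hi p \<and> 0 \<le> barrier (- 1) lo p"
  by (auto simp: K_open_def K_closed_def barrier_def zero_less_mult_iff zero_le_mult_iff
      mult_less_0_iff mult_le_0_iff)

text \<open>An interior point \<open>p\<close> of \<open>D\<close> has positive barriers. For \<open>lam > 0\<close> a point of \<open>D\<close> with a
nonpositive barrier could never come close to \<open>p\<close>; for \<open>lam < 0\<close> the barriers stay nonnegative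
on whatever can be approached from \<open>p\<close>.\<close>

lemma approx_transitive_interior_subset:
  assumes lam: "lam \<noteq> 0" and at: "approx_transitive FX FY \<Omega> D" and "interior D \<noteq> {}"
  shows "D \<subseteq> ycoord -` (if lam > 0 then K_open else K_closed)"
proof -
  obtain p where p: "p \<in> interior D"
    using assms(3) by blast
  have eh: "1 * (v - hi) \<le> 0" if "lo \<le> v" "v \<le> hi" for v
    using that by simp
  have el: "(- 1) * (v - lo) \<le> 0" if "lo \<le> v" "v \<le> hi" for v
    using that by simp
  have pos: "0 < 1 * hi" "0 < (- 1) * lo"
    using lo_hi by auto
  have inner: "0 < barrier 1 hi p" "0 < barrier (- 1) lo p"
    using no_interior_point_outside[OF lam eh pos(1) at p]
      no_interior_point_outside[OF lam el pos(2) at p] by force+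
  have pD: "p \<in> D"
    using p interior_subset by blast
  have "q \<in> ycoord -` (if lam > 0 then K_open else K_closed)" if q: "q \<in> D" for q
  proof (cases "lam > 0")
    case True
    have "p \<in> closure (positive_orbit FX FY \<Omega> q)"
      using at q pD by (auto simp: approx_transitive_def)
    then have "0 < barrier 1 hi q" "0 < barrier (- 1) lo q"
      using closure_orbit_barrier_unstable[OF lam eh True, of q p]
        closure_orbit_barrier_unstable[OF lam el True, of q p] inner by force+
    then show ?thesis
      using True by (simp add: ycoord_in_K_iff_barrier)
  next
    case False
    then have neg: "lam < 0" using lam by simp
    have "q \<in> closure (positive_orbit FX FY \<Omega> p)"
      using at q pD by (auto simp: approx_transitive_def)
    then have "0 \<le> barrier 1 hi q" "0 \<le> barrier (- 1) lo q"
      using closure_orbit_barrier_stable[OF lam eh neg, of q p]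
        closure_orbit_barrier_stable[OF lam el neg, of q p] inner by force+
    then show ?thesis
      using False by (simp add: ycoord_in_K_iff_barrier)
  qed
  then show ?thesis by blast
qed

section \<open>Controllability when the trace is nonzero\<close>

text \<open>For a constant rate the equation \<open>y' = my - v\<close> is linear with constant coefficients. Written with
\<open>exp_primitive\<close>, its solution needs no case distinction at \<open>m = 0\<close>.\<close>

lemma flow_curve:
  fixes y v s t :: real
  assumes lam: "lam \<noteq> 0"
  defines "m \<equiv> lam - sig * v"
  defines "\<psi> \<equiv> \<lambda>s. ypoint (t + v * s) (y + (m * y - v) * exp_primitive m s)"
  shows "(\<psi> has_vector_derivative FX (\<psi> s) + (v / \<alpha>) *\<^sub>R FY (\<psi> s)) (at s)"
  unfolding \<psi>_def
proof (rule ypoint_curve[OF lam])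
  show "((\<lambda>s. t + v * s) has_real_derivative v) (at s)"
    by (auto intro!: derivative_eq_intros)
  have "exp (m * s) = 1 + m * exp_primitive m s"
    by (simp add: exp_primitive_eq)
  then have "(m * y - v) * exp (m * s) = m * (y + (m * y - v) * exp_primitive m s) - v"
    by (simp add: algebra_simps)
  also have "\<dots> = lam * (y + (m * y - v) * exp_primitive m s) -
      v * (sig * (y + (m * y - v) * exp_primitive m s) + 1)"
    by (simp add: m_def algebra_simps)
  finally show "((\<lambda>s. y + (m * y - v) * exp_primitive m s) has_real_derivative
      lam * (y + (m * y - v) * exp_primitive m s) -
      v * (sig * (y + (m * y - v) * exp_primitive m s) + 1)) (at s)"
    by (auto intro!: derivative_eq_intros simp: mult_ac)
qed

lemma lifts_flow:
  assumes "lam \<noteq> 0" "lo \<le> v" "v \<le> hi" "0 \<le> T"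
  shows "lifts (ypoint t y)
    (ypoint (t + v * T) (y + ((lam - sig * v) * y - v) * exp_primitive (lam - sig * v) T))"
  using lifts_curve[OF flow_curve[OF assms(1), where t = t and y = y and v = v]
      control_of_rate[OF assms(2,3)] assms(4)] by simp

text \<open>The rate \<open>lo\<close> increases \<open>y\<close> and the rate \<open>hi\<close> decreases it, throughout \<open>K_open\<close>. The displacement
\<open>d\<close> of \<open>t\<close> on the way does not depend on the starting point, because \<open>y\<close> evolves independently of \<open>t\<close>.\<close>

lemma lifts_steer:
  assumes lam: "lam \<noteq> 0" and y: "y0 \<in> K_open" "y1 \<in> K_open"
  obtains d where "\<And>t. lifts (ypoint t y0) (ypoint (t + d) y1)"
proof -
  have key: "\<exists>d. \<forall>t. lifts (ypoint t y0) (ypoint (t + d) y1)"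
    if v: "lo \<le> v" "v \<le> hi" and
      same: "0 \<le> (y1 - y0) / ((lam - sig * v) * y0 - v)"
        "0 < ((lam - sig * v) * y1 - v) / ((lam - sig * v) * y0 - v)" for v
  proof -
    let ?m = "lam - sig * v"
    let ?r = "(y1 - y0) / (?m * y0 - v)"
    have nz: "?m * y0 - v \<noteq> 0"
      using same(2) by auto
    then have "1 + ?m * ?r = (?m * y1 - v) / (?m * y0 - v)"
      by (simp add: divide_simps) (simp add: algebra_simps)
    then have "0 < 1 + ?m * ?r"
      using same(2) by simp
    then obtain T where T: "0 \<le> T" "exp_primitive ?m T = ?r"
      using exp_primitive_onto[OF same(1)] by blast
    have "y0 + (?m * y0 - v) * exp_primitive ?m T = y1"
      using nz by (simp add: T(2))
    then have "lifts (ypoint t y0) (ypoint (t + v * T) y1)" for t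
      using lifts_flow[OF lam v T(1), of t y0] by simp
    then show ?thesis by blast
  qed
  have "\<exists>d. \<forall>t. lifts (ypoint t y0) (ypoint (t + d) y1)"
  proof (cases "y0 \<le> y1")
    case True
    have "0 < (lam - sig * lo) * y0 - lo" "0 < (lam - sig * lo) * y1 - lo"
      using y by (simp_all add: K_open_def algebra_simps)
    then show ?thesis
      using True lo_hi by (intro key[of lo]) auto
  next
    case False
    have "(lam - sig * hi) * y0 - hi < 0" "(lam - sig * hi) * y1 - hi < 0"
      using y by (simp_all add: K_open_def algebra_simps)
    then show ?thesis
      using False lo_hi by (intro key[of hi]) (auto simp: zero_le_divide_iff zero_less_divide_iff)
  qed
  then show ?thesis
    using that by blast
qed

lemma lifts_drift:
  assumes "lam \<noteq> 0" "lo \<le> v" "v \<le> hi" "lam * y = v * (sig * y + 1)" "0 \<le> T"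
  shows "lifts (ypoint t y) (ypoint (t + v * T) y)"
proof -
  have "(lam - sig * v) * y - v = 0"
    using assms(4) by (simp add: algebra_simps)
  then show ?thesis
    using lifts_flow[OF assms(1,2,3,5), of t y] by simp
qed

lemma equilibrium_in_K_open:
  assumes lam: "lam \<noteq> 0" and v: "lo < v" "v < hi" "\<bar>sig * v\<bar> < \<bar>lam\<bar>"
  obtains y where "y \<in> K_open" "lam * y = v * (sig * y + 1)"
proof -
  define z where "z = lam / (lam - sig * v)"
  have nz: "lam - sig * v \<noteq> 0"
    using v(3) by auto
  have z: "sig * (v / (lam - sig * v)) + 1 = z" "lam * (v / (lam - sig * v)) = v * z"
    using nz by (simp_all add: z_def divide_simps)
  have "0 < z"
    using v(3) by (auto simp: z_def zero_less_divide_iff)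
  then have "v / (lam - sig * v) \<in> K_open"
    unfolding K_open_def mem_Collect_eq z using v(1,2) by (simp add: mult_strict_right_mono)
  then show ?thesis
    using that z by simp
qed

text \<open>Between three steering phases for \<open>y\<close>, two equilibria with rates of opposite sign are held for as
long as it takes to correct \<open>t\<close>.\<close>

lemma lifts_K_open:
  assumes lam: "lam \<noteq> 0" and y: "y0 \<in> K_open" "y1 \<in> K_open"
  shows "lifts (ypoint t0 y0) (ypoint t1 y1)"
proof -
  \<comment> \<open>a rate below this bound keeps \<open>lam - \<sigma>v\<close> nonzero with the sign of \<open>lam\<close>\<close>
  have small: "\<bar>sig * (\<bar>lam\<bar> / (\<bar>sig\<bar> + 1) / 2)\<bar> < \<bar>lam\<bar>"
    using lam by (simp add: abs_mult divide_simps) (smt (verit) mult_pos_pos zero_less_abs_iff)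
  define c where "c = \<bar>lam\<bar> / (\<bar>sig\<bar> + 1) / 2"
  have c: "0 < c" "\<bar>sig\<bar> * c < \<bar>lam\<bar>"
    using small lam by (auto simp: c_def abs_mult)
  define vp where "vp = min (hi / 2) c"
  define vm where "vm = max (lo / 2) (- c)"
  have bounds: "\<bar>vp\<bar> \<le> c" "\<bar>vm\<bar> \<le> c" "0 < vp" "vp < hi" "vm < 0" "lo < vm" "lo < vp" "vm < hi"
    using c lo_hi by (auto simp: vp_def vm_def min_def max_def)
  have "\<bar>sig * vp\<bar> < \<bar>lam\<bar>" "\<bar>sig * vm\<bar> < \<bar>lam\<bar>"
    using mult_left_mono[OF bounds(1), of "\<bar>sig\<bar>"] mult_left_mono[OF bounds(2), of "\<bar>sig\<bar>"] c(2)
    by (auto simp: abs_mult)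
  then obtain yp ym where yp: "yp \<in> K_open" "lam * yp = vp * (sig * yp + 1)"
    and ym: "ym \<in> K_open" "lam * ym = vm * (sig * ym + 1)"
    using equilibrium_in_K_open[OF lam] bounds by metis
  obtain d1 where d1: "\<And>t. lifts (ypoint t y0) (ypoint (t + d1) yp)"
    using lifts_steer[OF lam y(1) yp(1)] by blast
  obtain d2 where d2: "\<And>t. lifts (ypoint t yp) (ypoint (t + d2) ym)"
    using lifts_steer[OF lam yp(1) ym(1)] by blast
  obtain d3 where d3: "\<And>t. lifts (ypoint t ym) (ypoint (t + d3) y1)"
    using lifts_steer[OF lam ym(1) y(2)] by blast
  have "vp * vm < 0"
    using bounds by (simp add: mult_pos_neg)
  then obtain S T where ST: "0 < S" "0 < T" "S * vp + T * vm = t1 - t0 - d1 - d2 - d3"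
    by (rule positive_combination)
  have "lifts (ypoint t0 y0) (ypoint (t0 + d1) yp)"
    by (rule d1)
  also have "lifts \<dots> (ypoint (t0 + d1 + vp * S) yp)"
    using bounds yp(2) ST(1) by (intro lifts_drift lam) auto
  also have "lifts \<dots> (ypoint (t0 + d1 + vp * S + d2) ym)"
    by (rule d2)
  also have "lifts \<dots> (ypoint (t0 + d1 + vp * S + d2 + vm * T) ym)"
    using bounds ym(2) ST(2) by (intro lifts_drift lam) auto
  also have "lifts \<dots> (ypoint (t0 + d1 + vp * S + d2 + vm * T + d3) y1)"
    by (rule d3)
  also have "t0 + d1 + vp * S + d2 + vm * T + d3 = t1"
    using ST(3) by (simp add: algebra_simps)
  finally show ?thesis .
qed

text \<open>The second common left eigenvector is \<open>m = R(An)\<close>, which annihilates the image of \<open>A\<close>. At \<open>y = 0\<close>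
the drift \<open>Av + Lambda \<theta> t \<xi>\<close> is parallel to \<open>w\<close>, and pairing it with \<open>m\<close> gives its
signed length.\<close>

lemma fibre_drift:
  assumes lam: "lam \<noteq> 0"
  obtains c \<kappa> where "c \<noteq> 0"
    "\<And>t x. quot_proj w x = ypoint t 0 \<Longrightarrow> X x = (0, (c * exp_primitive \<kappa> t) *\<^sub>R w)"
proof -
  define m where "m = rot90 (A *v n)"
  define \<kappa> where "\<kappa> = w \<bullet> (\<theta> *v w)"
  have mA: "m \<bullet> (A *v v) = 0" for v
    by (subst A_apply) (simp add: m_def rot90_inner(2))
  have mw: "m \<bullet> w = - lam"
    unfolding m_def rot90_inner(1)[of "A *v n" w] lam_def by (simp add: inner_commute[of n])
  have "A *v n - ((A *v n) \<bullet> w) *\<^sub>R w = lam *\<^sub>R n"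
    by (metis An add_diff_cancel_right')
  then have n: "n = (1 / lam) *\<^sub>R (A *v n - ((A *v n) \<bullet> w) *\<^sub>R w)"
    using lam by simp
  have m\<theta>w: "m \<bullet> (\<theta> *v w) = \<kappa> * (m \<bullet> w)"
    by (subst theta_w) (simp add: \<kappa>_def)
  have m\<theta>A: "m \<bullet> (\<theta> *v (A *v n)) = 0"
    using mA[of "\<theta> *v n"] by (simp add: matrix_vector_mul_assoc comm)
  have m\<theta>n: "m \<bullet> (\<theta> *v n) = \<kappa> * (m \<bullet> n)"
  proof -
    have "\<theta> *v n = (1 / lam) *\<^sub>R (\<theta> *v (A *v n) - ((A *v n) \<bullet> w) *\<^sub>R (\<theta> *v w))"
      by (subst n) (simp only: matrix_vector_mult_scaleR matrix_vector_mult_diff_distrib)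
    moreover have "m \<bullet> n = (1 / lam) * (m \<bullet> (A *v n) - ((A *v n) \<bullet> w) * (m \<bullet> w))"
      by (subst n) (simp only: inner_scaleR_right inner_diff_right)
    ultimately show ?thesis
      by (simp add: inner_diff_right m\<theta>A m\<theta>w mA)
  qed
  have m\<theta>: "m \<bullet> (\<theta> *v v) = \<kappa> * (m \<bullet> v)" for v
  proof -
    have "m \<bullet> (\<theta> *v v) = (v \<bullet> n) * (m \<bullet> (\<theta> *v n)) + (v \<bullet> w) * (m \<bullet> (\<theta> *v w))"
      by (subst decomp[of v])
        (simp only: matrix_vector_right_distrib matrix_vector_mult_scaleR inner_add_right
          inner_scaleR_right)
    also have "\<dots> = \<kappa> * (m \<bullet> ((v \<bullet> n) *\<^sub>R n + (v \<bullet> w) *\<^sub>R w))"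
      by (simp add: m\<theta>n m\<theta>w inner_add_right algebra_simps)
    finally show ?thesis
      by (simp only: decomp[symmetric])
  qed
  have "m \<noteq> 0"
    using mw lam by auto
  have "\<alpha> * (m \<bullet> \<xi>) + 0 * (m \<bullet> \<eta>) \<noteq> 0"
    by (rule LARC_eigencovector[OF comm larc _ m\<theta> \<open>m \<noteq> 0\<close>]) (simp add: mA)
  then have "- (m \<bullet> \<xi>) / lam \<noteq> 0"
    using lam by simp
  moreover have "X x = (0, (- (m \<bullet> \<xi>) / lam * exp_primitive \<kappa> t) *\<^sub>R w)"
    if x: "quot_proj w x = ypoint t 0" for t x
  proof -
    obtain v where v: "x = (t, v)"
      using x by (cases x) (auto simp: ypoint_def)
    let ?z = "A *v v + Lambda \<theta> t \<xi>"
    have "FX (ypoint t 0) = (0, ?z \<bullet> n)"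
      unfolding x[symmetric] FX_related by (simp add: v)
    moreover have "FX (ypoint t 0) = (0, 0)"
      using lam b_nonzero alpha_nonzero
      by (simp add: FX_def ypoint_def right_diff_distrib) (simp add: b_def algebra_simps)
    ultimately have "?z \<bullet> n = 0" by simp
    then have z: "?z = (?z \<bullet> w) *\<^sub>R w"
      by (intro trans[OF decomp[of ?z]]) simp
    have "(?z \<bullet> w) * (m \<bullet> w) = m \<bullet> ?z"
      by (subst (2) z) simp
    also have "\<dots> = exp_primitive \<kappa> t * (m \<bullet> \<xi>)"
      by (simp add: inner_add_right mA inner_Lambda_eigen[OF m\<theta>])
    finally have "?z \<bullet> w = - (m \<bullet> \<xi>) / lam * exp_primitive \<kappa> t"
      using lam by (simp add: mw field_simps)
    then show ?thesis
      using z by (simp add: v)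
  qed
  ultimately show thesis
    by (rule that)
qed

lemma zero_in_K_open: "0 \<in> K_open"
  using lo_hi by (simp add: K_open_def)

lemma transitive_over_K_open:
  assumes lam: "lam \<noteq> 0" and x: "ycoord (quot_proj w x) \<in> K_open" "ycoord (quot_proj w x') \<in> K_open"
  shows "x' \<in> positive_orbit X Y \<Omega> x"
proof -
  obtain c \<kappa> where c: "c \<noteq> 0"
    "\<And>t x. quot_proj w x = ypoint t 0 \<Longrightarrow> X x = (0, (c * exp_primitive \<kappa> t) *\<^sub>R w)"
    using fibre_drift[OF lam] by blast
  have "(c * exp_primitive \<kappa> 1) * (c * exp_primitive \<kappa> (- 1)) =
      c\<^sup>2 * (exp_primitive \<kappa> 1 * exp_primitive \<kappa> (- 1))"
    by (simp add: power2_eq_square)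
  also have "\<dots> < 0"
    using c(1) exp_primitive_sign(1)[of 1 \<kappa>] exp_primitive_sign(2)[of "- 1" \<kappa>]
    by (intro mult_pos_neg) (auto intro: mult_pos_neg)
  finally have opp: "(c * exp_primitive \<kappa> 1) * (c * exp_primitive \<kappa> (- 1)) < 0" .
  show ?thesis
  proof (rule transitive_over[OF _ _ c(2) _ c(2) opp])
    fix p p' assume "p \<in> ycoord -` K_open" "p' \<in> ycoord -` K_open"
    then show "lifts p p'"
      using lifts_K_open[OF lam, of "ycoord p" "ycoord p'" "fst p" "fst p'"] by (simp add: ypoint_ycoord[OF lam])
  qed (use x zero_in_K_open in \<open>simp_all add: ycoord_ypoint[OF lam]\<close>)
qed

section \<open>Controllability when the trace vanishes\<close>

lemma lifts_move:
  assumes lam: "lam = 0"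
  obtains d where "\<And>s. lifts (t, s) (t', s + d)"
proof -
  \<comment> \<open>run at an extreme rate, in the direction of \<open>t'\<close>\<close>
  obtain v T where v: "lo \<le> v" "v \<le> hi" "0 \<le> T" "v * T = t' - t"
  proof (cases "t \<le> t'")
    case True
    then show ?thesis
      using lo_hi by (intro that[of hi "(t' - t) / hi"]) auto
  next
    case False
    then show ?thesis
      using lo_hi by (intro that[of lo "(t' - t) / lo"]) (auto simp: zero_le_divide_iff)
  qed
  define f where "f = (\<lambda>r. E (t + v * r) * (n \<bullet> \<xi>) + (v / \<alpha>) * (exp (sig * (t + v * r)) * (n \<bullet> \<eta>)))"
  have "continuous_on UNIV f"
    unfolding f_def by (intro continuous_intros)
  then obtain F where F: "F 0 = 0" "\<And>r. (F has_real_derivative f r) (at r)"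
    by (rule ex_antiderivative) (rule that)
  have "lifts (t, s) (t', s + F T)" for s
  proof -
    let ?\<psi> = "\<lambda>r. (t + v * r, s + F r)"
    have "((\<lambda>r. t + v * r) has_real_derivative v) (at r)" for r
      by (auto intro!: derivative_eq_intros)
    moreover have "((\<lambda>r. s + F r) has_real_derivative f r) (at r)" for r
      using F(2)[of r] by (auto intro!: derivative_eq_intros)
    ultimately have "(?\<psi> has_vector_derivative (v, f r)) (at r)" for r
      by (intro has_vector_derivative_Pair)
        (simp_all add: has_real_derivative_iff_has_vector_derivative)
    moreover have "(v, f r) = FX (?\<psi> r) + (v / \<alpha>) *\<^sub>R FY (?\<psi> r)" for r
      using alpha_nonzero by (simp add: FX_def FY_def f_def lam)
    ultimately have "(?\<psi> has_vector_derivative FX (?\<psi> r) + (v / \<alpha>) *\<^sub>R FY (?\<psi> r)) (at r)" for r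
      by metis
    from lifts_curve[OF this control_of_rate[OF v(1,2)] v(3)] show ?thesis
      using v(4) by (simp add: F(1))
  qed
  then show ?thesis by (rule that)
qed

lemma rest_curve:
  assumes "lam = 0"
  shows "((\<lambda>r. (t, s + r * (E t * (n \<bullet> \<xi>)))) has_vector_derivative
    FX (t, s + r * (E t * (n \<bullet> \<xi>))) + 0 *\<^sub>R FY (t, s + r * (E t * (n \<bullet> \<xi>)))) (at r)"
proof -
  have "((\<lambda>r. s + r * (E t * (n \<bullet> \<xi>))) has_real_derivative E t * (n \<bullet> \<xi>)) (at r)"
    by (auto intro!: derivative_eq_intros)
  then have "((\<lambda>r. (t, s + r * (E t * (n \<bullet> \<xi>)))) has_vector_derivative (0, E t * (n \<bullet> \<xi>))) (at r)"
    by (intro has_vector_derivative_Pair)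
      (simp_all add: has_real_derivative_iff_has_vector_derivative)
  then show ?thesis
    by (simp add: FX_def assms)
qed

lemma zero_control: "0 \<in> \<Omega>"
  using range0 by simp

lemma lifts_rest:
  assumes "lam = 0" "0 \<le> T"
  shows "lifts (t, s) (t, s + T * (E t * (n \<bullet> \<xi>)))"
  using lifts_curve[OF rest_curve[OF assms(1)] zero_control assms(2), of t s] by simp

text \<open>Waiting at \<open>t = 1\<close> and at \<open>t = -1\<close> changes \<open>s\<close> in opposite directions.\<close>

lemma lifts_all:
  assumes lam: "lam = 0"
  shows "lifts p p'"
proof -
  obtain t s t' s' where p: "p = (t, s)" "p' = (t', s')"
    by (cases p, cases p')
  obtain d1 where d1: "\<And>s. lifts (t, s) (1, s + d1)"
    using lifts_move[OF lam] by blast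
  obtain d2 where d2: "\<And>s. lifts (1, s) (- 1, s + d2)"
    using lifts_move[OF lam] by blast
  obtain d3 where d3: "\<And>s. lifts (- 1, s) (t', s + d3)"
    using lifts_move[OF lam] by blast
  define c where "c = n \<bullet> \<xi>"
  have "c \<noteq> 0"
    using b_nonzero lam by (simp add: b_def c_def)
  have "E 1 * E (- 1) < 0"
    using exp_primitive_sign(1)[of 1 sig] exp_primitive_sign(2)[of "- 1" sig]
    by (intro mult_pos_neg) auto
  then have "c\<^sup>2 * (E 1 * E (- 1)) < 0"
    using \<open>c \<noteq> 0\<close> by (intro mult_pos_neg[OF _ \<open>E 1 * E (- 1) < 0\<close>]) simp
  then have "(E 1 * c) * (E (- 1) * c) < 0"
    by (simp add: power2_eq_square mult_ac)
  then obtain S T where ST: "0 < S" "0 < T"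
      "S * (E 1 * c) + T * (E (- 1) * c) = s' - s - d1 - d2 - d3"
    by (rule positive_combination)
  have "lifts (t, s) (1, s + d1)"
    by (rule d1)
  also have "lifts \<dots> (1, s + d1 + S * (E 1 * c))"
    using lifts_rest[OF lam, of S] ST(1) by (simp add: c_def)
  also have "lifts \<dots> (- 1, s + d1 + S * (E 1 * c) + d2)"
    by (rule d2)
  also have "lifts \<dots> (- 1, s + d1 + S * (E 1 * c) + d2 + T * (E (- 1) * c))"
    using lifts_rest[OF lam, of T "- 1"] ST(2) by (simp add: c_def)
  also have "lifts \<dots> (t', s + d1 + S * (E 1 * c) + d2 + T * (E (- 1) * c) + d3)"
    by (rule d3)
  also have "s + d1 + S * (E 1 * c) + d2 + T * (E (- 1) * c) + d3 = s'"
    using ST(3) by (simp add: algebra_simps)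
  finally show ?thesis
    unfolding p .
qed

text \<open>Over \<open>(0, c)\<close> the drift is \<open>c (An)\<close>, and \<open>An\<close> is a nonzero multiple of \<open>w\<close>.\<close>

lemma transitive_lam_zero:
  assumes lam: "lam = 0"
  shows "x' \<in> positive_orbit X Y \<Omega> x"
proof -
  define \<mu> where "\<mu> = (A *v n) \<bullet> w"
  have An: "A *v n = \<mu> *\<^sub>R w"
    using An by (simp add: lam \<mu>_def)
  then have "\<mu> \<noteq> 0"
    using An_nonzero by auto
  have X0: "X x = (0, (c * \<mu>) *\<^sub>R w)" if x: "quot_proj w x = (0, c)" for c x
  proof -
    obtain v where "x = (0, v)" "v \<bullet> n = c"
      using x by (cases x) auto
    then show ?thesis
      using A_apply[of v] by (simp add: Lambda_0 An)
  qed
  show ?thesis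
  proof (rule transitive_over[of UNIV, OF _ _ X0 _ X0])
    show "(1 * \<mu>) * (- 1 * \<mu>) < 0"
      using \<open>\<mu> \<noteq> 0\<close> by (auto simp: mult_less_0_iff zero_less_mult_iff linorder_neq_iff)
  qed (simp_all add: lifts_all[OF lam])
qed

section \<open>The control set\<close>

definition C_H :: "(real \<times> real) set" where
  "C_H = (if lam = 0 then UNIV else ycoord -` (if lam > 0 then K_open else K_closed))"

lemma K_open_subset_K_closed: "K_open \<subseteq> K_closed"
  by (auto simp: K_open_def K_closed_def)

lemma K_closed_scale:
  assumes y: "y \<in> K_closed" and r: "0 \<le> r" "r < 1"
  shows "r * y \<in> K_open"
proof -
  have "r * (lo * (sig * y + 1)) \<le> r * (lam * y)" "r * (lam * y) \<le> r * (hi * (sig * y + 1))"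
    using y r by (auto simp: K_closed_def mult_left_mono)
  moreover have "(1 - r) * lo < 0" "0 < (1 - r) * hi"
    using r lo_hi by (auto simp: mult_pos_neg)
  ultimately show ?thesis
    by (simp add: K_open_def algebra_simps)
qed

text \<open>Since \<open>lo < 0 < hi\<close>, the inequalities of \<open>K_closed\<close> force \<open>\<sigma>y + 1 > 0\<close>, so the rate that holds
\<open>y\<close> fixed is \<open>lam y / (\<sigma>y + 1)\<close>.\<close>

lemma K_closed_rate:
  assumes lam: "lam \<noteq> 0" and y: "y \<in> K_closed"
  obtains v where "lo \<le> v" "v \<le> hi" "lam * y = v * (sig * y + 1)"
proof -
  let ?z = "sig * y + 1"
  have k: "lo * ?z \<le> lam * y" "lam * y \<le> hi * ?z"
    using y by (auto simp: K_closed_def)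
  have "0 < ?z"
  proof (rule ccontr)
    assume "\<not> 0 < ?z"
    then have s: "hi * ?z \<le> 0" "0 \<le> lo * ?z"
      using lo_hi by (auto intro: mult_nonneg_nonpos mult_nonpos_nonpos)
    then have "lam * y = 0" "hi * ?z = 0"
      using k by linarith+
    then show False
      using lam lo_hi by auto
  qed
  then have "lo \<le> lam * y / ?z" "lam * y / ?z \<le> hi" "lam * y = lam * y / ?z * ?z"
    using k by (simp_all add: le_divide_eq divide_le_eq)
  then show ?thesis by (rule that)
qed

text \<open>A constant control suffices: zero if \<open>lam = 0\<close>, and otherwise the one whose rate holds \<open>y\<close> fixed.\<close>

lemma weakly_invariant_C_H: "weakly_invariant X Y \<Omega> (quot_proj w -` C_H)"
  unfolding weakly_invariant_def
proof (intro ballI)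
  fix x assume x: "x \<in> quot_proj w -` C_H"
  have key: "\<exists>u\<in>controls \<Omega>. \<exists>\<phi>. solution X Y u x \<phi> \<and> \<phi> ` {0..} \<subseteq> quot_proj w -` C_H"
    if \<psi>: "\<And>s. (\<psi> has_vector_derivative FX (\<psi> s) + u *\<^sub>R FY (\<psi> s)) (at s)"
      and u: "u \<in> \<Omega>" and \<psi>0: "quot_proj w x = \<psi> 0" and C: "\<And>s. \<psi> s \<in> C_H" for \<psi> u
  proof -
    from \<psi> \<psi>0 obtain \<phi> where \<phi>: "\<phi> 0 = x" "\<And>s. quot_proj w (\<phi> s) = \<psi> s"
      "\<And>s. (\<phi> has_vector_derivative X (\<phi> s) + u *\<^sub>R Y (\<phi> s)) (at s)"
      by (rule lift_curve) (rule that)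
    have "\<phi> ` {0..} \<subseteq> quot_proj w -` C_H"
      using C by (auto simp: \<phi>(2))
    then show ?thesis
      using solution_constant_control[OF \<phi>(3)] constant_in_controls[OF u] unfolding \<phi>(1)
      by (intro bexI[of _ "\<lambda>_. u"] exI[of _ \<phi>] conjI)
  qed
  show "\<exists>u\<in>controls \<Omega>. \<exists>\<phi>. solution X Y u x \<phi> \<and> \<phi> ` {0..} \<subseteq> quot_proj w -` C_H"
  proof (cases "lam = 0")
    case True
    show ?thesis
      by (rule key[OF rest_curve[OF True, of "fst (quot_proj w x)" "snd (quot_proj w x)"] zero_control])
        (simp_all add: C_H_def True)
  next
    case False
    define p where "p = quot_proj w x"
    have y: "ycoord p \<in> (if lam > 0 then K_open else K_closed)"
      using x False by (simp add: C_H_def p_def)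
    then have "ycoord p \<in> K_closed"
      using K_open_subset_K_closed by (auto split: if_splits)
    then obtain v where v: "lo \<le> v" "v \<le> hi" "lam * ycoord p = v * (sig * ycoord p + 1)"
      by (rule K_closed_rate[OF False]) (rule that)
    let ?\<psi> = "\<lambda>s. ypoint (fst p + v * s) (ycoord p)"
    have "(?\<psi> has_vector_derivative FX (?\<psi> s) + (v / \<alpha>) *\<^sub>R FY (?\<psi> s)) (at s)" for s
      by (rule ypoint_curve[OF False]) (auto intro!: derivative_eq_intros simp: v(3))
    then show ?thesis
    proof (rule key[OF _ control_of_rate[OF v(1,2)]])
      show "quot_proj w x = ?\<psi> 0"
        by (simp add: ypoint_ycoord[OF False] p_def)
      show "?\<psi> s \<in> C_H" for s
        using y by (simp add: C_H_def False ycoord_ypoint[OF False])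
    qed
  qed
qed

lemma closure_over_K_open:
  assumes lam: "lam \<noteq> 0" and x: "ycoord (quot_proj w x) \<in> K_closed"
  shows "x \<in> closure (quot_proj w -` ycoord -` K_open)"
proof -
  define p where "p = quot_proj w x"
  define g where "g = (\<lambda>r. (fst p, snd x + (snd (ypoint (fst p) (r * ycoord p)) - snd p) *\<^sub>R n))"
  have "quot_proj w (g r) = ypoint (fst p) (r * ycoord p)" for r
    by (simp add: g_def p_def quot_proj_eq inner_add_left frame prod_eq_iff)
  then have "g ` {0..<1} \<subseteq> quot_proj w -` ycoord -` K_open"
    using K_closed_scale[OF x] by (auto simp: ycoord_ypoint[OF lam] p_def)
  moreover have "continuous_on {0..1} g"
    unfolding g_def by (intro continuous_intros continuous_on_ypoint)
  then have "continuous_on (closure {0..<1}) g"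
    by (simp add: closure_atLeastLessThan)
  ultimately have "g ` closure {0..<1} \<subseteq> closure (quot_proj w -` ycoord -` K_open)"
    by (intro image_closure_subset closed_closure order_trans[OF _ closure_subset])
  then have "g 1 \<in> closure (quot_proj w -` ycoord -` K_open)"
    by (auto simp: closure_atLeastLessThan)
  moreover have "g 1 = x"
    by (simp add: g_def ypoint_ycoord[OF lam]) (simp add: p_def quot_proj_eq)
  ultimately show ?thesis by simp
qed

lemma approx_transitive_C_H: "approx_transitive X Y \<Omega> (quot_proj w -` C_H)"
  unfolding approx_transitive_def
proof (intro ballI)
  fix x assume x: "x \<in> quot_proj w -` C_H"
  consider "lam = 0" | "lam > 0" | "lam < 0" by linarith
  then show "quot_proj w -` C_H \<subseteq> closure (positive_orbit X Y \<Omega> x)"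
  proof cases
    case 1
    then have "positive_orbit X Y \<Omega> x = UNIV"
      using transitive_lam_zero by blast
    then show ?thesis by simp
  next
    case 2
    then have lam: "lam \<noteq> 0" and C: "C_H = ycoord -` K_open"
      by (simp_all add: C_H_def)
    have "quot_proj w -` C_H \<subseteq> positive_orbit X Y \<Omega> x"
    proof
      fix x' assume "x' \<in> quot_proj w -` C_H"
      with x show "x' \<in> positive_orbit X Y \<Omega> x"
        unfolding C by (intro transitive_over_K_open[OF lam]) simp_all
    qed
    then show ?thesis
      using closure_subset by (rule subset_trans)
  next
    case 3
    then have lam: "lam \<noteq> 0" by simp
    define p where "p = quot_proj w x"
    have y: "ycoord p \<in> K_closed"
      using x 3 by (simp add: C_H_def p_def)
    have "ycoord p + ((lam - sig * 0) * ycoord p - 0) * exp_primitive (lam - sig * 0) 1 = exp lam * ycoord p"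
    proof -
      have "exp lam = 1 + lam * exp_primitive lam 1"
        by (simp add: exp_primitive_eq)
      then show ?thesis
        by (simp add: algebra_simps)
    qed
    then have "lifts p (ypoint (fst p) (exp lam * ycoord p))"
      using lifts_flow[OF lam, of 0 1 "fst p" "ycoord p"] lo_hi by (simp add: ypoint_ycoord[OF lam])
    then obtain x1 where x1: "quot_proj w x1 = ypoint (fst p) (exp lam * ycoord p)" "reachable X Y \<Omega> x x1"
      unfolding lifts_def p_def by blast
    have "ycoord (quot_proj w x1) \<in> K_open"
      unfolding x1(1) ycoord_ypoint[OF lam] using 3 by (intro K_closed_scale y) auto
    then have "quot_proj w -` ycoord -` K_open \<subseteq> positive_orbit X Y \<Omega> x"
      using transitive_over_K_open[OF lam] reachable_positive_orbit(1)[OF x1(2)] by blast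
    moreover have "quot_proj w -` C_H \<subseteq> closure (quot_proj w -` ycoord -` K_open)"
      using closure_over_K_open[OF lam] 3 by (auto simp: C_H_def)
    ultimately show ?thesis
      by (meson closure_mono subset_trans)
  qed
qed

lemma open_over_K_open: "open (ycoord -` K_open)"
proof -
  have "open K_open"
    unfolding K_open_def by (intro open_Collect_conj open_Collect_less continuous_intros)
  then show ?thesis
    by (intro open_vimage continuous_on_ycoord)
qed

lemma closed_over_K_closed: "closed (ycoord -` K_closed)"
proof -
  have "closed K_closed"
    unfolding K_closed_def by (intro closed_Collect_conj closed_Collect_le continuous_intros)
  then show ?thesis
    by (intro closed_vimage continuous_on_ycoord)
qed

lemma interior_C_H: "interior C_H \<noteq> {}"
proof (cases "lam = 0")
  case True
  then show ?thesis by (simp add: C_H_def)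
next
  case False
  have "ycoord -` K_open \<subseteq> C_H"
    using K_open_subset_K_closed by (auto simp: C_H_def)
  then have "ycoord -` K_open \<subseteq> interior C_H"
    by (intro interior_maximal open_over_K_open)
  moreover have "ypoint 0 0 \<in> ycoord -` K_open"
    using zero_in_K_open by (simp add: ycoord_ypoint[OF False])
  ultimately show ?thesis by blast
qed

lemma approx_transitive_subset_C_H:
  assumes "approx_transitive FX FY \<Omega> D" "interior D \<noteq> {}"
  shows "D \<subseteq> C_H"
  using approx_transitive_interior_subset[OF _ assms] by (auto simp: C_H_def)

lemma open_or_closed_over_C_H:
  shows "lam > 0 \<Longrightarrow> open (quot_proj w -` C_H)"
    and "lam < 0 \<Longrightarrow> closed (quot_proj w -` C_H)"
    and "lam = 0 \<Longrightarrow> quot_proj w -` C_H = UNIV"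
  using open_over_K_open closed_over_K_closed
  by (auto simp: C_H_def intro!: open_vimage closed_vimage linear_continuous_on
      bounded_linear_quot_proj)

end

theorem theorem4p2:
  fixes \<theta> A :: "real^2^2" and \<xi> \<eta> w :: "real^2" and \<alpha> u_lo u_hi :: real
  assumes "admissible \<theta>"
    and "A ** \<theta> = \<theta> ** A"
    and "rank A = 1"
    and "u_lo < 0" and "0 < u_hi"
    and "LARC (linear_field \<theta> A \<xi>) (left_invariant_field \<theta> \<alpha> \<eta>)"
    and "A *v w = 0" and "norm w = 1"
  shows "\<exists>C C_H.
      unique_control_set_with_interior
        (linear_field \<theta> A \<xi>) (left_invariant_field \<theta> \<alpha> \<eta>) {u_lo..u_hi} C \<and>
      unique_control_set_with_interior
        (proj_field (quot_proj w) (linear_field \<theta> A \<xi>))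
        (proj_field (quot_proj w) (left_invariant_field \<theta> \<alpha> \<eta>)) {u_lo..u_hi} C_H \<and>
      C = quot_proj w -` C_H \<and>
      C = times_kernel w C_H \<and>
      (trace A > 0 \<longrightarrow> open C) \<and>
      (trace A < 0 \<longrightarrow> closed C) \<and>
      (trace A = 0 \<longrightarrow> C = UNIV)"
proof -
  have "A \<noteq> 0"
    using assms(3) by auto
  then interpret nilrank_one \<theta> A \<xi> \<eta> w \<alpha> u_lo u_hi
    using assms by unfold_locales
  have rel: "\<And>x. FX (quot_proj w x) = quot_proj w (X x)" "\<And>x. FY (quot_proj w x) = quot_proj w (Y x)"
    by (rule FX_related FY_related)+
  note unique = unique_control_set_fibration[OF bounded_linear_quot_proj surj_quot_proj[OF unit_w] rel
      weakly_invariant_C_H approx_transitive_C_H interior_C_H approx_transitive_subset_C_H]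
  show ?thesis
    unfolding trace_eq proj_field_X proj_field_Y
    by (intro exI[of _ "quot_proj w -` C_H"] exI[of _ C_H] conjI impI unique refl
        vimage_quot_proj_eq_times_kernel unit_w open_or_closed_over_C_H)
qed

end
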